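(* Every compact LOTS which does not contain a Cantor subset is pseudo-removable (PR).
   Context: All spaces are Hausdorff. A LOTS is a linearly ordered set with its order topology. A Cantor subset is a subspace homeomorphic to the Cantor set. For compact $X$, $C(X)=C(X,\mathbb{C})$ carries the supremum norm, and $\mathcal{A}\sqsubseteq^{c} C(X)$ means that $\mathcal{A}$ is a closed complex subalgebra of $C(X)$ which separates points and contains the constant functions. An idempotent is an $f\in C(X)$ with $f^2=f$; the trivial idempotents are the constants $0$ and $1$. For $\mathcal{A}\sqsubseteq^{c} C(X)$, a closed $H\subseteq X$ is a boundary for $\mathcal{A}$ iff $\sup_{x\in H}|f(x)| = \|f\|$ for all $f\in\mathcal{A}$; the Šilov boundary $\mathrm{Sh}(\mathcal{A})$ is the smallest closed boundary for $\mathcal{A}$ (it exists). A compact space $H$ is removable iff for all $X,U,\mathcal{A}$: if $X$ is compact, $U\subsetneqq X$ is open, $\overline U$ is homeomorphic to a subspace of $H$, $\mathcal{A}\sqsubseteq^{c} C(X)$, and all idempotents of $\mathcal{A}$ are trivial, then $\mathrm{Sh}(\mathcal{A})\subseteq X\setminus U$. For a regular (complex) Borel measure $\mu$ on a compact space $H$, $\mathrm{supt}(\mu)$ is its closed support, i.e. the complement of the union of all open sets $V$ with $|\mu|(V)=0$. A compact space $H$ is pseudo-removable (PR) iff $\mathrm{supt}(\mu)$ is removable for every regular Borel measure $\mu$ on $H$. *)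

theory Defs
  imports "HOL-Analysis.Analysis"
begin

definition cantor_set :: "real set" where
  "cantor_set = {\<Sum>n. d n / 3 ^ Suc n | d :: nat \<Rightarrow> real. range d \<subseteq> {0, 2}}"

text \<open>
  For compact \<open>X\<close> the underlying set of \<open>cfunspace X euclidean_metric\<close> is \<open>C(X)\<close>, and its metric is
  the one given by the supremum norm. Its elements are extensional functions (\<open>undefined\<close> outside
  \<open>topspace X\<close>), so two of them are equal iff they agree on \<open>topspace X\<close>; this is why the algebra
  operations below are restricted to \<open>topspace X\<close>.
\<close>

abbreviation C_space :: "'x topology \<Rightarrow> ('x \<Rightarrow> complex) metric" where
  "C_space X \<equiv> cfunspace X euclidean_metric"

definition closed_subalgebra :: "'x topology \<Rightarrow> ('x \<Rightarrow> complex) set \<Rightarrow> bool" where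
  "closed_subalgebra X \<A> \<longleftrightarrow>
     closedin (mtopology_of (C_space X)) \<A> \<and>
     (\<forall>f\<in>\<A>. \<forall>g\<in>\<A>. (\<lambda>x\<in>topspace X. f x + g x) \<in> \<A>) \<and>
     (\<forall>f\<in>\<A>. \<forall>g\<in>\<A>. (\<lambda>x\<in>topspace X. f x * g x) \<in> \<A>) \<and>
     (\<forall>c. \<forall>f\<in>\<A>. (\<lambda>x\<in>topspace X. c * f x) \<in> \<A>) \<and>
     (\<forall>c. (\<lambda>x\<in>topspace X. c) \<in> \<A>) \<and>
     (\<forall>x\<in>topspace X. \<forall>y\<in>topspace X. x \<noteq> y \<longrightarrow> (\<exists>f\<in>\<A>. f x \<noteq> f y))"

definition idempotents_trivial :: "'x topology \<Rightarrow> ('x \<Rightarrow> complex) set \<Rightarrow> bool" where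
  "idempotents_trivial X \<A> \<longleftrightarrow>
     (\<forall>f\<in>\<A>. (\<lambda>x\<in>topspace X. (f x)\<^sup>2) = f \<longrightarrow>
        f = (\<lambda>x\<in>topspace X. 0) \<or> f = (\<lambda>x\<in>topspace X. 1))"

text \<open>The suprema are taken in \<open>[0, \<infinity>]\<close>, so that the supremum over the empty set is \<open>0\<close>.\<close>

definition is_boundary :: "'x topology \<Rightarrow> ('x \<Rightarrow> complex) set \<Rightarrow> 'x set \<Rightarrow> bool" where
  "is_boundary X \<A> H \<longleftrightarrow>
     closedin X H \<and>
     (\<forall>f\<in>\<A>. (SUP x\<in>H. ennreal (cmod (f x))) = (SUP x\<in>topspace X. ennreal (cmod (f x))))"

text \<open>\<open>LEAST\<close> refers to the order on sets, i.e. inclusion.\<close>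

definition shilov_boundary :: "'x topology \<Rightarrow> ('x \<Rightarrow> complex) set \<Rightarrow> 'x set" where
  "shilov_boundary X \<A> = (LEAST H. is_boundary X \<A> H)"

text \<open>
  The space \<open>X\<close> ranges over all topologies carried by subsets of the type \<open>'x\<close>. A quantifier over
  types being unavailable inside a formula, \<open>'x\<close> is a parameter; ``for all \<open>X\<close>'' is
  obtained by leaving it a free type variable in a theorem that concludes removability.
\<close>

definition removable :: "'x itself \<Rightarrow> 'h topology \<Rightarrow> bool" where
  "removable (_ :: 'x itself) H \<longleftrightarrow>
     compact_space H \<and> Hausdorff_space H \<and>
     (\<forall>(X :: 'x topology) U \<A>.
        compact_space X \<and> Hausdorff_space X \<and>
        openin X U \<and> U \<subset> topspace X \<and>
        (\<exists>S. S \<subseteq> topspace H \<and> subtopology X (X closure_of U) homeomorphic_space subtopology H S) \<and>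
        closed_subalgebra X \<A> \<and> idempotents_trivial X \<A>
        \<longrightarrow> shilov_boundary X \<A> \<subseteq> topspace X - U)"

definition borel_sets :: "'h topology \<Rightarrow> 'h set set" where
  "borel_sets H = sigma_sets (topspace H) {U. openin H U}"

text \<open>Only the values of \<open>\<mu>\<close> on Borel sets are relevant.\<close>

definition complex_borel_measure :: "'h topology \<Rightarrow> ('h set \<Rightarrow> complex) \<Rightarrow> bool" where
  "complex_borel_measure H \<mu> \<longleftrightarrow>
     \<mu> {} = 0 \<and>
     (\<forall>A :: nat \<Rightarrow> 'h set. range A \<subseteq> borel_sets H \<and> disjoint_family A \<longrightarrow>
        (\<lambda>n. \<mu> (A n)) sums \<mu> (\<Union>n. A n))"

definition total_variation :: "'h topology \<Rightarrow> ('h set \<Rightarrow> complex) \<Rightarrow> 'h set \<Rightarrow> ennreal" where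
  "total_variation H \<mu> E =
     (SUP A \<in> {A :: nat \<Rightarrow> 'h set. range A \<subseteq> borel_sets H \<and> disjoint_family A \<and> (\<Union>n. A n) = E}.
        \<Sum>n. ennreal (cmod (\<mu> (A n))))"

definition regular_complex_borel_measure :: "'h topology \<Rightarrow> ('h set \<Rightarrow> complex) \<Rightarrow> bool" where
  "regular_complex_borel_measure H \<mu> \<longleftrightarrow>
     complex_borel_measure H \<mu> \<and>
     (\<forall>E\<in>borel_sets H.
        total_variation H \<mu> E = (INF V \<in> {V. openin H V \<and> E \<subseteq> V}. total_variation H \<mu> V) \<and>
        total_variation H \<mu> E = (SUP K \<in> {K. compactin H K \<and> K \<subseteq> E}. total_variation H \<mu> K))"

definition supt :: "'h topology \<Rightarrow> ('h set \<Rightarrow> complex) \<Rightarrow> 'h set" where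
  "supt H \<mu> = topspace H - \<Union>{V. openin H V \<and> total_variation H \<mu> V = 0}"

definition pseudo_removable :: "'x itself \<Rightarrow> 'h topology \<Rightarrow> bool" where
  "pseudo_removable (T :: 'x itself) H \<longleftrightarrow>
     compact_space H \<and> Hausdorff_space H \<and>
     (\<forall>\<mu>. regular_complex_borel_measure H \<mu> \<longrightarrow> removable T (subtopology H (supt H \<mu>)))"

end

theory Submission
  imports Defs
begin

text \<open>
  Let \<open>m\<close> be the distribution function of the total variation of \<open>\<mu>\<close>. On the support of \<open>\<mu>\<close> it is
  strictly increasing except that it may identify the two end points of a jump, that is, of a pair of
  adjacent points. Suppose that \<open>X - U\<close> is not a boundary, so that some \<open>f\<close> in the algebra
  with norm \<open>1 = f x0\<close> is bounded by \<open>r < 1\<close> on \<open>X - U\<close>. If \<open>Re g\<close> omits a value \<open>c\<close> that lies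
  between two of its values, then \<open>sgn (Re g - c)\<close> is in the algebra, which yields a nontrivial
  idempotent. Hence \<open>Re f\<close> takes all values in \<open>(r, 1)\<close>, and the compact set \<open>L\<close> of the points with
  \<open>Re f \<ge> (r + 1) / 2\<close> is uncountable. As \<open>L\<close> contains no Cantor set, uncountably many jumps with both
  end points in \<open>L\<close> are identified by \<open>m\<close>. For each such jump \<open>a < b\<close> the algebra contains a
  \<open>g\<close> with \<open>g a = 0\<close> and \<open>g b = 1\<close> that is small on \<open>X - U\<close>. By a pigeonhole argument there are two
  such functions whose difference is close to \<open>0\<close> or to one of the jumps of the first function at every
  point of \<open>U\<close>, and close to \<open>1\<close> somewhere. A continuous function has only finitely many jumps larger than a
  given size, so the real part of the difference omits some \<open>c\<close> with \<open>1 / 2 < c < 3 / 4\<close>, which is the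
  desired contradiction.
\<close>

section \<open>Total variation and the support of a measure\<close>

locale complex_measure =
  fixes H :: "'h topology" and \<mu> :: "'h set \<Rightarrow> complex"
  assumes complex_borel_measure: "complex_borel_measure H \<mu>"
begin

sublocale sigma_algebra "topspace H" "borel_sets H"
  unfolding borel_sets_def
  by (rule sigma_algebra_sigma_sets) (auto dest: openin_subset)

abbreviation tv :: "'h set \<Rightarrow> ennreal" where "tv \<equiv> total_variation H \<mu>"

definition partitions :: "'h set \<Rightarrow> (nat \<Rightarrow> 'h set) set" where
  "partitions E = {P. range P \<subseteq> borel_sets H \<and> disjoint_family P \<and> (\<Union>n. P n) = E}"

lemma tv_eq: "tv E = (SUP P\<in>partitions E. \<Sum>n. ennreal (cmod (\<mu> (P n))))"
  unfolding total_variation_def partitions_def by simp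

lemma measure_empty: "\<mu> {} = 0"
  using complex_borel_measure by (simp add: complex_borel_measure_def)

lemma measure_sums:
  assumes "P \<in> partitions E" shows "(\<lambda>n. \<mu> (P n)) sums \<mu> E"
  using complex_borel_measure assms unfolding complex_borel_measure_def partitions_def by blast

lemma partitions_binaryset:
  assumes "A \<in> borel_sets H" "B \<in> borel_sets H" "A \<inter> B = {}"
  shows "binaryset A B \<in> partitions (A \<union> B)"
  using assms unfolding partitions_def
  by (auto simp: range_binaryset_eq UN_binaryset_eq disjoint_family_on_def binaryset_def)

lemma measure_Un:
  assumes "A \<in> borel_sets H" "B \<in> borel_sets H" "A \<inter> B = {}"
  shows "\<mu> (A \<union> B) = \<mu> A + \<mu> B"
  using measure_sums[OF partitions_binaryset[OF assms]] binaryset_sums[of \<mu> A B, OF measure_empty]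
  by (rule sums_unique2)

lemma measure_UN:
  assumes "range P \<subseteq> borel_sets H" "disjoint_family P" "finite I"
  shows "\<mu> (\<Union>i\<in>I. P i) = (\<Sum>i\<in>I. \<mu> (P i))"
  using assms(3)
proof (induction I)
  case empty then show ?case by (simp add: measure_empty)
next
  case (insert i I)
  have "\<mu> (P i \<union> (\<Union>j\<in>I. P j)) = \<mu> (P i) + \<mu> (\<Union>j\<in>I. P j)"
  proof (rule measure_Un)
    show "P i \<inter> (\<Union>j\<in>I. P j) = {}"
    proof -
      have "P i \<inter> P j = {}" if "j \<in> I" for j
        using that insert.hyps(2) by (intro disjoint_family_onD[OF assms(2)]) auto
      then show ?thesis by blast
    qed
    show "P i \<in> borel_sets H" using assms(1) by (rule subsetD) simp
    show "(\<Union>j\<in>I. P j) \<in> borel_sets H" using insert(1) assms(1) by (intro finite_UN) auto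
  qed
  then show ?case by (simp add: insert.IH insert.hyps)
qed

text \<open>Prepending \<open>B\<close> to a partition of \<open>A\<close> gives a partition of the
  union whose sum is larger by \<open>cmod (\<mu> B)\<close>. Dropping this term yields
  monotonicity; a nonzero term yields strict increase when \<open>tv A\<close> is finite.\<close>

lemma tv_Un_ge:
  assumes A: "A \<in> borel_sets H" and B: "B \<in> borel_sets H" and "A \<inter> B = {}"
  shows "tv A + ennreal (cmod (\<mu> B)) \<le> tv (A \<union> B)"
proof -
  have "binaryset A {} \<in> partitions A" using partitions_binaryset[of A "{}"] A by simp
  then have "tv A + ennreal (cmod (\<mu> B))
      = (SUP P\<in>partitions A. (\<Sum>n. ennreal (cmod (\<mu> (P n)))) + ennreal (cmod (\<mu> B)))"
    unfolding tv_eq by (intro ennreal_SUP_add_left[symmetric]) blast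
  also have "\<dots> \<le> tv (A \<union> B)"
  proof (rule SUP_least)
    fix P assume P: "P \<in> partitions A"
    define Q where "Q = case_nat B P"
    have disj: "P n \<inter> B = {}" for n
      using P assms(3) unfolding partitions_def by blast
    have "Q \<in> partitions (A \<union> B)"
    proof -
      have "range Q = insert B (range P)"
        by (subst UNIV_nat_eq) (simp add: Q_def image_image)
      moreover have "disjoint_family Q"
        using P disj unfolding partitions_def disjoint_family_on_def Q_def
        by (auto split: nat.splits)
      ultimately show ?thesis using P B unfolding partitions_def by auto
    qed
    have "(\<lambda>n. ennreal (cmod (\<mu> (Q (Suc n))))) sums (\<Sum>n. ennreal (cmod (\<mu> (P n))))"
      by (simp add: Q_def summable_sums)
    from sums_Suc[OF this]
    have "(\<Sum>n. ennreal (cmod (\<mu> (P n)))) + ennreal (cmod (\<mu> B)) = (\<Sum>n. ennreal (cmod (\<mu> (Q n))))"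
      by (simp add: sums_iff Q_def)
    also have "\<dots> \<le> tv (A \<union> B)"
      unfolding tv_eq using \<open>Q \<in> partitions (A \<union> B)\<close> by (rule SUP_upper)
    finally show "(\<Sum>n. ennreal (cmod (\<mu> (P n)))) + ennreal (cmod (\<mu> B)) \<le> tv (A \<union> B)" .
  qed
  finally show ?thesis .
qed

lemma tv_mono:
  assumes "A \<in> borel_sets H" "B \<in> borel_sets H" "A \<subseteq> B"
  shows "tv A \<le> tv B"
proof -
  have "tv A \<le> tv A + ennreal (cmod (\<mu> (B - A)))" by simp
  also have "\<dots> \<le> tv (A \<union> (B - A))" by (rule tv_Un_ge) (use assms in auto)
  also have "A \<union> (B - A) = B" using assms(3) by blast
  finally show ?thesis .
qed

text \<open>Each piece of a partition of the union is cut into its traces on \<open>A\<close> and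
  \<open>B\<close>, and the triangle inequality is applied piece by piece.\<close>

lemma tv_Un_le:
  assumes A: "A \<in> borel_sets H" and B: "B \<in> borel_sets H" and "A \<inter> B = {}"
  shows "tv (A \<union> B) \<le> tv A + tv B"
  unfolding tv_eq[of "A \<union> B"]
proof (rule SUP_least)
  fix P assume P: "P \<in> partitions (A \<union> B)"
  then have "P n \<in> borel_sets H" for n by (auto simp: partitions_def)
  then have int: "P n \<inter> A \<in> borel_sets H" "P n \<inter> B \<in> borel_sets H" for n
    using A B by auto
  moreover have "disjoint_family (\<lambda>n. P n \<inter> A)" "disjoint_family (\<lambda>n. P n \<inter> B)"
    using P unfolding partitions_def disjoint_family_on_def by blast+
  ultimately have PA: "(\<lambda>n. P n \<inter> A) \<in> partitions A" and PB: "(\<lambda>n. P n \<inter> B) \<in> partitions B"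
    using P unfolding partitions_def by auto
  have "\<mu> (P n) = \<mu> (P n \<inter> A) + \<mu> (P n \<inter> B)" for n
  proof -
    have "\<mu> ((P n \<inter> A) \<union> (P n \<inter> B)) = \<mu> (P n \<inter> A) + \<mu> (P n \<inter> B)"
      by (rule measure_Un[OF int]) (use assms(3) in auto)
    moreover have "(P n \<inter> A) \<union> (P n \<inter> B) = P n" using P unfolding partitions_def by blast
    ultimately show ?thesis by simp
  qed
  then have "(\<Sum>n. ennreal (cmod (\<mu> (P n))))
      \<le> (\<Sum>n. ennreal (cmod (\<mu> (P n \<inter> A))) + ennreal (cmod (\<mu> (P n \<inter> B))))"
    by (intro suminf_le summableI) (simp add: ennreal_plus[symmetric] ennreal_leI norm_triangle_ineq del: ennreal_plus)
  also have "\<dots> = (\<Sum>n. ennreal (cmod (\<mu> (P n \<inter> A)))) + (\<Sum>n. ennreal (cmod (\<mu> (P n \<inter> B))))"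
    by (rule suminf_add[symmetric]) (rule summableI)+
  also have "\<dots> \<le> tv A + tv B"
    unfolding tv_eq by (intro add_mono SUP_upper2[OF PA] SUP_upper2[OF PB] order_refl)
  finally show "(\<Sum>n. ennreal (cmod (\<mu> (P n)))) \<le> tv A + tv B" .
qed

text \<open>Every finite subsum of the values on a partition is the measure of a subset of
  \<open>E\<close>. Vectors whose subsums are bounded by \<open>t\<close> have norms adding up to at
  most twice the dimension times \<open>t\<close>, hence the factor 4.\<close>

lemma tv_le_if_bounded:
  assumes "\<And>A. A \<in> borel_sets H \<Longrightarrow> A \<subseteq> E \<Longrightarrow> cmod (\<mu> A) \<le> t"
  shows "tv E \<le> ennreal (4 * t)"
  unfolding tv_eq
proof (rule SUP_least)
  fix P assume P: "P \<in> partitions E"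
  show "(\<Sum>n. ennreal (cmod (\<mu> (P n)))) \<le> ennreal (4 * t)"
    unfolding suminf_eq_SUP
  proof (rule SUP_least)
    fix n
    have le: "(\<Sum>i<n. cmod (\<mu> (P i))) \<le> 2 * real DIM(complex) * t"
    proof (rule sum_norm_allsubsets_bound)
      fix I assume "I \<subseteq> {..<n}"
      then have fin: "finite I" by (rule finite_subset) simp
      have "(\<Sum>i\<in>I. \<mu> (P i)) = \<mu> (\<Union>i\<in>I. P i)"
        using P fin by (intro measure_UN[symmetric]) (auto simp: partitions_def)
      then show "cmod (\<Sum>i\<in>I. \<mu> (P i)) \<le> t"
        using assms[of "\<Union>i\<in>I. P i"] P fin by (auto simp: partitions_def)
    qed simp
    have "(\<Sum>i<n. ennreal (cmod (\<mu> (P i)))) = ennreal (\<Sum>i<n. cmod (\<mu> (P i)))"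
      by (rule sum_ennreal) simp
    also have "\<dots> \<le> ennreal (4 * t)"
      using le by (intro ennreal_leI) simp
    finally show "(\<Sum>i<n. ennreal (cmod (\<mu> (P i)))) \<le> ennreal (4 * t)" .
  qed
qed

text \<open>By \<open>tv_le_if_bounded\<close> some \<open>A\<close> inside \<open>E\<close> has
  measure exceeding \<open>1 + cmod (\<mu> E)\<close> in modulus. Then \<open>A\<close> and
  \<open>E - A\<close> both have measure of modulus at least 1, and by subadditivity one of them has
  infinite variation; that one is \<open>D\<close>.\<close>

lemma tv_infinite_split:
  assumes E: "E \<in> borel_sets H" and inf: "tv E = \<infinity>"
  obtains D where "D \<in> borel_sets H" "D \<subseteq> E" "tv D = \<infinity>" "cmod (\<mu> (E - D)) \<ge> 1"
proof -
  have "\<exists>A. A \<in> borel_sets H \<and> A \<subseteq> E \<and> cmod (\<mu> A) > 1 + cmod (\<mu> E)"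
  proof (rule ccontr)
    assume "\<not> ?thesis"
    then have "cmod (\<mu> A) \<le> 1 + cmod (\<mu> E)" if "A \<in> borel_sets H" "A \<subseteq> E" for A
      using that by (simp add: not_less)
    from tv_le_if_bounded[of E, OF this] show False using inf by (simp add: top_unique)
  qed
  then obtain A where A: "A \<in> borel_sets H" "A \<subseteq> E" "cmod (\<mu> A) > 1 + cmod (\<mu> E)"
    by (elim exE conjE)
  have B: "E - A \<in> borel_sets H" by (rule Diff[OF E A(1)])
  have E_eq: "A \<union> (E - A) = E" using A(2) by (rule Diff_partition)
  have disj: "A \<inter> (E - A) = {}" by (rule Diff_disjoint)
  have "\<mu> E = \<mu> A + \<mu> (E - A)" using measure_Un[OF A(1) B disj] unfolding E_eq .
  then have "cmod (\<mu> A) \<le> cmod (\<mu> E) + cmod (\<mu> (E - A))"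
    using norm_triangle_ineq4[of "\<mu> E" "\<mu> (E - A)"] by simp
  then have 1: "cmod (\<mu> (E - A)) \<ge> 1" using A(3) by linarith
  have 2: "cmod (\<mu> A) \<ge> 1" using A(3) norm_ge_zero[of "\<mu> E"] by linarith
  have "tv E \<le> tv A + tv (E - A)" using tv_Un_le[OF A(1) B disj] unfolding E_eq .
  then have "tv A + tv (E - A) = \<infinity>" unfolding inf by (simp add: top_unique)
  then have "tv A = \<infinity> \<or> tv (E - A) = \<infinity>" by simp
  then show ?thesis
  proof
    assume "tv A = \<infinity>" then show ?thesis by (rule that[OF A(1,2) _ 1])
  next
    assume *: "tv (E - A) = \<infinity>"
    have "E - (E - A) = A" using A(2) by (rule double_diff) simp
    then show ?thesis using that[OF B Diff_subset *] 2 by simp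
  qed
qed

text \<open>Repeated splitting peels off disjoint pieces of measure at least 1 in modulus, against
  the convergence of the series of their measures.\<close>

lemma tv_finite: "tv (topspace H) < \<infinity>"
proof (rule ccontr)
  assume "\<not> ?thesis"
  then have inf: "tv (topspace H) = \<infinity>" by (simp add: less_top[symmetric])
  have "\<exists>E. \<forall>n. (E n \<in> borel_sets H \<and> tv (E n) = \<infinity>) \<and>
      (E (Suc n) \<subseteq> E n \<and> cmod (\<mu> (E n - E (Suc n))) \<ge> 1)"
  proof (rule dependent_nat_choice)
    show "\<exists>D. (D \<in> borel_sets H \<and> tv D = \<infinity>) \<and> (D \<subseteq> E \<and> cmod (\<mu> (E - D)) \<ge> 1)"
      if "E \<in> borel_sets H \<and> tv E = \<infinity>" for E :: "'h set" and n :: nat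
    proof -
      from that have "E \<in> borel_sets H" "tv E = \<infinity>" by blast+
      then obtain D where "D \<in> borel_sets H" "D \<subseteq> E" "tv D = \<infinity>" "cmod (\<mu> (E - D)) \<ge> 1"
        by (rule tv_infinite_split)
      then show ?thesis by blast
    qed
    show "\<exists>E. E \<in> borel_sets H \<and> tv E = \<infinity>" using inf top by blast
  qed
  then obtain E where E: "\<And>n. E n \<in> borel_sets H" "\<And>n. E (Suc n) \<subseteq> E n"
    "\<And>n. cmod (\<mu> (E n - E (Suc n))) \<ge> 1" by blast
  have dec: "E n \<subseteq> E m" if "m \<le> n" for m n
    using that E(2) by (rule lift_Suc_antimono_le[rotated])
  define P where "P n = E n - E (Suc n)" for n
  have disj: "P m \<inter> P n = {}" if "m < n" for m n
    using dec[of "Suc m" n] that unfolding P_def by auto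
  have "disjoint_family P"
    unfolding disjoint_family_on_def using disj by (metis Int_commute linorder_neqE_nat)
  then have "P \<in> partitions (\<Union>n. P n)"
    using E(1) unfolding partitions_def P_def by auto
  then have "(\<lambda>n. \<mu> (P n)) \<longlonglongrightarrow> 0"
    by (intro summable_LIMSEQ_zero sums_summable[OF measure_sums])
  then have "(\<lambda>n. cmod (\<mu> (P n))) \<longlonglongrightarrow> 0" by (rule tendsto_norm_zero)
  then have "\<forall>\<^sub>F n in sequentially. cmod (\<mu> (P n)) < 1" by (rule order_tendstoD) simp
  then obtain n where "cmod (\<mu> (P n)) < 1" by (auto simp: eventually_sequentially)
  then show False using E(3)[of n] by (simp add: P_def)
qed

end

text \<open>\<open>m a\<close> is the total variation of \<open>{..a}\<close>. An open interval
  around a point of the support contains a Borel set of nonzero measure, which raises the finite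
  variation strictly.\<close>

lemma supt_distribution:
  fixes \<mu> :: "'a::linorder_topology set \<Rightarrow> complex"
  assumes "complex_borel_measure euclidean \<mu>"
  obtains m :: "'a \<Rightarrow> real" where "mono m"
    "\<And>a b c. b \<in> supt euclidean \<mu> \<Longrightarrow> a < b \<Longrightarrow> b < c \<Longrightarrow> m a < m c"
proof -
  interpret complex_measure euclidean \<mu> by unfold_locales (rule assms)
  have open_borel: "U \<in> borel_sets euclidean" if "open U" for U :: "'a set"
    using that unfolding borel_sets_def by (auto intro: sigma_sets.Basic)
  have borel: "{..a} \<in> borel_sets euclidean" for a :: 'a
  proof -
    have "topspace euclidean - {a<..} \<in> borel_sets euclidean"
      by (intro compl_sets open_borel) simp
    moreover have "topspace euclidean - {a<..} = {..a}" by auto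
    ultimately show ?thesis by simp
  qed
  have fin: "tv A < \<infinity>" if "A \<in> borel_sets euclidean" for A
    by (rule le_less_trans[OF tv_mono[OF that top] tv_finite]) simp
  define m where "m a = enn2real (tv {..a})" for a
  show ?thesis
  proof
    show "mono m"
    proof (rule monoI)
      fix a b :: 'a assume "a \<le> b"
      then have "tv {..a} \<le> tv {..b}" by (intro tv_mono borel) auto
      then show "m a \<le> m b"
        unfolding m_def by (rule enn2real_mono) (use fin[OF borel] in simp)
    qed
    fix a b c :: 'a assume b: "b \<in> supt euclidean \<mu>" "a < b" "b < c"
    have "b \<in> {a<..<c}" "open {a<..<c}" using b by auto
    then have "tv {a<..<c} \<noteq> 0" using b(1) unfolding supt_def open_openin[symmetric] by blast
    have "\<exists>P\<in>partitions {a<..<c}. \<exists>n. \<mu> (P n) \<noteq> 0"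
    proof (rule ccontr)
      assume "\<not> ?thesis"
      then have "tv {a<..<c} \<le> 0"
        unfolding tv_eq by (intro SUP_least) simp
      then show False using \<open>tv {a<..<c} \<noteq> 0\<close> by simp
    qed
    then obtain P n where P: "P \<in> partitions {a<..<c}" and n: "\<mu> (P n) \<noteq> 0"
      by (elim bexE exE)
    have Pn: "P n \<in> borel_sets euclidean" "P n \<subseteq> {a<..<c}" using P by (auto simp: partitions_def)
    have "tv {..a} < tv {..a} + ennreal (cmod (\<mu> (P n)))"
      using ennreal_add_left_cancel_less[of "tv {..a}" 0] n fin[OF borel[of a]] by simp
    also have "\<dots> \<le> tv ({..a} \<union> P n)"
      by (rule tv_Un_ge[OF borel Pn(1)]) (use Pn(2) in force)
    also have "\<dots> \<le> tv {..c}"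
    proof (rule tv_mono)
      show "{..a} \<union> P n \<in> borel_sets euclidean" by (rule Un[OF borel Pn(1)])
      show "{..a} \<union> P n \<subseteq> {..c}" using Pn(2) b by force
    qed (rule borel)
    finally have "ennreal (m a) < ennreal (m c)"
      unfolding m_def using fin[OF borel[of a]] fin[OF borel[of c]] by simp
    then show "m a < m c"
      by (simp add: m_def ennreal_less_iff)
  qed
qed

section \<open>Cantor sets in ordered spaces\<close>

lemma compact_UNIV_bool_seq: "compact (UNIV :: (nat \<Rightarrow> bool) set)"
proof -
  have "compact (UNIV :: bool set)" by (intro finite_imp_compact) simp
  then have "compact_space (product_topology (\<lambda>i::nat. euclidean :: bool topology) UNIV)"
    unfolding compact_space_product_topology by (simp add: compact_space_def)
  then have "compact_space (euclidean :: (nat \<Rightarrow> bool) topology)"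
    by (simp only: euclidean_product_topology)
  then show ?thesis by (simp add: compact_space_def)
qed

text \<open>The sequences with a given finite prefix form an open set: a finite intersection of
  preimages of points of the discrete space \<open>bool\<close>.\<close>

lemma continuous_on_bool_seq:
  fixes F :: "(nat \<Rightarrow> bool) \<Rightarrow> 'b::topological_space"
  assumes "\<And>d U. open U \<Longrightarrow> F d \<in> U \<Longrightarrow> \<exists>n. \<forall>d'. (\<forall>i<n. d' i = d i) \<longrightarrow> F d' \<in> U"
  shows "continuous_on UNIV F"
  unfolding continuous_on_open_vimage[OF open_UNIV] Int_UNIV_right
proof (intro allI impI)
  fix U :: "'b set" assume U: "open U"
  show "open (F -` U)"
  proof (subst open_subopen, rule ballI)
    fix d assume "d \<in> F -` U"
    then obtain n where n: "\<And>d'. (\<forall>i<n. d' i = d i) \<Longrightarrow> F d' \<in> U"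
      using assms[OF U, of d] by auto
    have "open (\<Inter>i\<in>{..<n}. (\<lambda>d'. d' i) -` {d i})"
      by (intro open_INT ballI open_vimage open_discrete continuous_on_product_coordinates) simp
    moreover have "(\<Inter>i\<in>{..<n}. (\<lambda>d'. d' i) -` {d i}) \<subseteq> F -` U" using n by auto
    ultimately show "\<exists>T. open T \<and> d \<in> T \<and> T \<subseteq> F -` U" by (intro exI conjI) auto
  qed
qed

text \<open>The parametrization of the Cantor set by its ternary digits, with \<open>True\<close>
  for the digit 2. Boolean digits make the domain a compact product space.\<close>

definition ternary :: "(nat \<Rightarrow> bool) \<Rightarrow> real" where
  "ternary d = (\<Sum>n. (if d n then 2 else 0) / 3 ^ Suc n)"

lemma summable_ternary: "summable (\<lambda>n. (if d n then 2 else 0) / 3 ^ Suc n :: real)"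
proof (rule summable_comparison_test')
  show "summable (\<lambda>n. 2 / 3 * (1 / 3) ^ n :: real)" by (intro summable_mult summable_geometric) simp
qed (auto simp: power_divide)

lemma cantor_set_eq: "cantor_set = range ternary"
proof (intro equalityI subsetI)
  fix x assume "x \<in> cantor_set"
  then obtain e :: "nat \<Rightarrow> real" where e: "range e \<subseteq> {0, 2}" "x = (\<Sum>n. e n / 3 ^ Suc n)"
    unfolding cantor_set_def by blast
  have "(if e n = 2 then 2 else 0) = e n" for n
    using rangeI[of e n] e(1) by auto
  then have "x = ternary (\<lambda>n. e n = 2)"
    unfolding e(2) ternary_def by (simp only:)
  then show "x \<in> range ternary" by blast
next
  fix x assume "x \<in> range ternary"
  then obtain d where x: "x = ternary d" by blast
  have "range (\<lambda>n. if d n then 2 else 0 :: real) \<subseteq> {0, 2}" by auto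
  then show "x \<in> cantor_set"
    unfolding x ternary_def cantor_set_def
    by (intro CollectI exI[of _ "\<lambda>n. if d n then 2 else 0"]) simp
qed

text \<open>Self-similarity of the Cantor set: the first digit selects a third of the interval, the
  shifted sequence the position in it. Injectivity and continuity follow from this by
  induction.\<close>

lemma ternary_split: "ternary d = (if d 0 then 2 / 3 else 0) + ternary (\<lambda>n. d (Suc n)) / 3"
proof -
  have "(\<Sum>n. (if d (Suc n) then 2 else 0) / 3 ^ Suc (Suc n)) = ternary (\<lambda>n. d (Suc n)) / 3"
    unfolding ternary_def suminf_divide[OF summable_ternary, symmetric] by (simp add: field_simps)
  moreover have "(\<Sum>n. (if d (Suc n) then 2 else 0) / 3 ^ Suc (Suc n))
      = ternary d - (if d 0 then 2 / 3 else 0)"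
    unfolding ternary_def using suminf_split_head[OF summable_ternary[of d]] by simp
  ultimately show ?thesis by simp
qed

lemma ternary_bounds: "0 \<le> ternary d" "ternary d \<le> 1"
proof -
  show "0 \<le> ternary d"
    unfolding ternary_def by (intro suminf_nonneg summable_ternary) auto
  have "(\<lambda>n. 2 / 3 * (1 / 3) ^ n) sums (2 / 3 * (1 / (1 - 1 / 3)) :: real)"
    by (intro sums_mult geometric_sums) simp
  then have s: "(\<lambda>n. 2 / 3 ^ Suc n) sums (1 :: real)" by (simp add: power_divide)
  have "ternary d \<le> (\<Sum>n. 2 / 3 ^ Suc n)"
    unfolding ternary_def by (rule suminf_le[OF _ summable_ternary sums_summable[OF s]]) simp
  also have "\<dots> = 1" using s by (simp add: sums_iff)
  finally show "ternary d \<le> 1" .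
qed

lemma inj_ternary: "inj ternary"
proof (rule injI)
  fix d d' assume "ternary d = ternary d'"
  \<comment> \<open>The first digit is determined because the value is at most 1/3 or at least 2/3;
    the later digits follow by shifting.\<close>
  then have "d n = d' n" for n
  proof (induction n arbitrary: d d')
    case 0
    then show ?case
      using ternary_split[of d] ternary_split[of d'] ternary_bounds[of "\<lambda>n. d (Suc n)"]
        ternary_bounds[of "\<lambda>n. d' (Suc n)"] by (auto split: if_splits)
  next
    case (Suc n)
    have "d 0 = d' 0"
      using Suc.prems ternary_split[of d] ternary_split[of d'] ternary_bounds[of "\<lambda>n. d (Suc n)"]
        ternary_bounds[of "\<lambda>n. d' (Suc n)"] by (auto split: if_splits)
    then have "ternary (\<lambda>n. d (Suc n)) = ternary (\<lambda>n. d' (Suc n))"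
      using Suc.prems ternary_split[of d] ternary_split[of d'] by simp
    from Suc.IH[OF this] show ?case .
  qed
  then show "d = d'" by blast
qed

lemma ternary_close:
  "(\<And>i. i < n \<Longrightarrow> d' i = d i) \<Longrightarrow> \<bar>ternary d' - ternary d\<bar> \<le> 1 / 3 ^ n"
proof (induction n arbitrary: d d')
  case 0
  then show ?case using ternary_bounds[of d] ternary_bounds[of d'] by auto
next
  case (Suc n)
  have "\<bar>ternary (\<lambda>n. d' (Suc n)) - ternary (\<lambda>n. d (Suc n))\<bar> \<le> 1 / 3 ^ n"
    by (rule Suc.IH) (use Suc.prems in auto)
  moreover have "ternary d' - ternary d = (ternary (\<lambda>n. d' (Suc n)) - ternary (\<lambda>n. d (Suc n))) / 3"
    using Suc.prems[of 0] ternary_split[of d] ternary_split[of d'] by (simp add: diff_divide_distrib)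
  ultimately have "\<bar>ternary d' - ternary d\<bar> \<le> 1 / 3 ^ n / 3" by (simp only: abs_divide) simp
  then show ?case by (simp add: mult.commute)
qed

lemma bool_seq_homeomorphic_cantor_set: "(UNIV :: (nat \<Rightarrow> bool) set) homeomorphic cantor_set"
proof (rule homeomorphic_compact[OF compact_UNIV_bool_seq])
  show "continuous_on UNIV ternary"
  proof (rule continuous_on_bool_seq)
    fix d and U :: "real set" assume "open U" "ternary d \<in> U"
    then obtain e where e: "e > 0" "\<And>x. \<bar>x - ternary d\<bar> < e \<Longrightarrow> x \<in> U"
      unfolding open_dist dist_real_def by blast
    obtain n where n: "(1 / 3) ^ n < e" using real_arch_pow_inv[OF e(1), of "1 / 3"] by auto
    have "ternary d' \<in> U" if "\<forall>i<n. d' i = d i" for d'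
    proof (rule e(2))
      have "\<bar>ternary d' - ternary d\<bar> \<le> 1 / 3 ^ n" by (rule ternary_close) (use that in simp)
      then show "\<bar>ternary d' - ternary d\<bar> < e" using n by (simp add: power_one_over)
    qed
    then show "\<exists>n. \<forall>d'. (\<forall>i<n. d' i = d i) \<longrightarrow> ternary d' \<in> U" by blast
  qed
qed (simp_all add: cantor_set_eq inj_ternary)

section \<open>Countably many separating cuts and the Cantor scheme\<close>

lemma finite_if_subsingleton:
  assumes "\<And>x y. x \<in> S \<Longrightarrow> y \<in> S \<Longrightarrow> x = y"
  shows "finite S"
proof (cases "S = {}")
  case False
  then obtain x where "x \<in> S" by blast
  then have "S \<subseteq> {x}" using assms by blast
  then show ?thesis by (rule finite_subset) simp
qed simp

text \<open>A lower set is a cut of the order; countably many cuts that separate the points of a set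
  take the place of an embedding into the real line.\<close>

locale separating_cuts =
  fixes L :: "'a::linorder set" and C :: "nat \<Rightarrow> 'a set"
  assumes lower: "\<And>n x y. y \<in> C n \<Longrightarrow> x \<le> y \<Longrightarrow> x \<in> C n"
    and separates: "\<And>x y. x \<in> L \<Longrightarrow> y \<in> L \<Longrightarrow> x < y \<Longrightarrow> \<exists>n. x \<in> C n \<and> y \<notin> C n"
begin

text \<open>A non-maximal point of \<open>N\<close> lies in a cut \<open>C n\<close> that omits a
  larger point of \<open>N\<close>. So \<open>N\<close> consists of countably many countable traces
  \<open>N \<inter> C n\<close> and at most one maximum.\<close>

lemma countable_if_cut_lower:
  assumes "N \<subseteq> L" and cut: "\<And>n y. y \<in> N \<Longrightarrow> y \<notin> C n \<Longrightarrow> countable (N \<inter> C n)"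
  shows "countable N"
proof -
  define I where "I = {n. \<exists>y\<in>N. y \<notin> C n}"
  define M where "M = {x \<in> N. \<forall>y\<in>N. y \<le> x}"
  have "countable (\<Union>n\<in>I. N \<inter> C n)"
    using cut unfolding I_def by (intro countable_UN) auto
  moreover have "countable M"
    by (rule countable_finite, rule finite_if_subsingleton) (auto simp: M_def intro: order_antisym)
  moreover have "x \<in> (\<Union>n\<in>I. N \<inter> C n) \<union> M" if x: "x \<in> N" for x
  proof (cases "x \<in> M")
    case False
    then obtain y where y: "y \<in> N" "x < y" using x by (auto simp: M_def not_le)
    then obtain n where "x \<in> C n" "y \<notin> C n" using separates x assms(1) by blast
    then show ?thesis using x y(1) unfolding I_def by blast
  qed simp
  ultimately show ?thesis by (meson countable_Un countable_subset subsetI)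
qed

lemma countable_if_cut_upper:
  assumes "N \<subseteq> L" and cut: "\<And>n y. y \<in> N \<Longrightarrow> y \<in> C n \<Longrightarrow> countable (N - C n)"
  shows "countable N"
proof -
  define I where "I = {n. \<exists>y\<in>N. y \<in> C n}"
  define M where "M = {x \<in> N. \<forall>y\<in>N. x \<le> y}"
  have "countable (\<Union>n\<in>I. N - C n)"
    using cut unfolding I_def by (intro countable_UN) auto
  moreover have "countable M"
    by (rule countable_finite, rule finite_if_subsingleton) (auto simp: M_def intro: order_antisym)
  moreover have "x \<in> (\<Union>n\<in>I. N - C n) \<union> M" if x: "x \<in> N" for x
  proof (cases "x \<in> M")
    case False
    then obtain y where y: "y \<in> N" "y < x" using x by (auto simp: M_def not_le)
    then obtain n where "y \<in> C n" "x \<notin> C n" using separates x assms(1) by blast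
    then show ?thesis using x y(1) unfolding I_def by blast
  qed simp
  ultimately show ?thesis by (meson countable_Un countable_subset subsetI)
qed

text \<open>A point \<open>y\<close> outside \<open>C n\<close> is an upper bound of
  \<open>C n\<close>, so the trace on \<open>C n\<close> lies in the initial segment of
  \<open>P\<close> up to \<open>y\<close>.\<close>

lemma countable_initial_segments:
  assumes "P \<subseteq> L" shows "countable {x \<in> P. countable (P \<inter> {..x})}"
proof (rule countable_if_cut_lower)
  fix n y assume y: "y \<in> {x \<in> P. countable (P \<inter> {..x})}" "y \<notin> C n"
  have "x \<le> y" if "x \<in> C n" for x
    using lower[OF that, of y] y(2) linear by blast
  then have "{x \<in> P. countable (P \<inter> {..x})} \<inter> C n \<subseteq> P \<inter> {..y}" by auto
  then show "countable ({x \<in> P. countable (P \<inter> {..x})} \<inter> C n)"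
    by (rule countable_subset) (use y(1) in simp)
qed (use assms in auto)

lemma countable_final_segments:
  assumes "P \<subseteq> L" shows "countable {x \<in> P. countable (P \<inter> {x..})}"
proof (rule countable_if_cut_upper)
  fix n y assume y: "y \<in> {x \<in> P. countable (P \<inter> {x..})}" "y \<in> C n"
  have "y \<le> x" if "x \<notin> C n" for x
    using lower[OF y(2), of x] that linear by blast
  then have "{x \<in> P. countable (P \<inter> {x..})} - C n \<subseteq> P \<inter> {y..}" by auto
  then show "countable ({x \<in> P. countable (P \<inter> {x..})} - C n)"
    by (rule countable_subset) (use y(1) in simp)
qed (use assms in auto)

text \<open>Only countably many points of \<open>P\<close> have countably many points of
  \<open>P\<close> on one of their sides. Any two of the others, in increasing order, serve as
  \<open>c\<close> and \<open>c'\<close>.\<close>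

lemma uncountable_split:
  assumes P: "P \<subseteq> L" "uncountable P"
  obtains c c' where "c \<in> P" "c' \<in> P" "c < c'" "uncountable (P \<inter> {..c})" "uncountable (P \<inter> {c'..})"
proof -
  define R where "R = P - ({x \<in> P. countable (P \<inter> {..x})} \<union> {x \<in> P. countable (P \<inter> {x..})})"
  have "uncountable R"
    unfolding R_def
    by (rule uncountable_minus_countable[OF P(2) countable_Un[OF countable_initial_segments[OF P(1)]
          countable_final_segments[OF P(1)]]])
  then have "infinite R" using countable_finite by blast
  from infinite_imp_nonempty[OF this] obtain c where c: "c \<in> R" by blast
  from \<open>infinite R\<close> have "infinite (R - {c})" by simp
  from infinite_imp_nonempty[OF this] obtain c' where "c' \<in> R - {c}" by blast
  with c have "c \<in> R" "c' \<in> R" "c \<noteq> c'" by auto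
  have R: "x \<in> P" "uncountable (P \<inter> {..x})" "uncountable (P \<inter> {x..})" if "x \<in> R" for x
    using that unfolding R_def by blast+
  consider "c < c'" | "c' < c" using \<open>c \<noteq> c'\<close> by (rule linorder_neqE)
  then show ?thesis
  proof cases
    case 1 then show ?thesis using that[OF R(1) R(1) _ R(2,3)] \<open>c \<in> R\<close> \<open>c' \<in> R\<close> by metis
  next
    case 2 then show ?thesis using that[OF R(1) R(1) _ R(2,3)] \<open>c \<in> R\<close> \<open>c' \<in> R\<close> by metis
  qed
qed

lemma uncountable_interval:
  assumes P: "P \<subseteq> L" "uncountable P"
  obtains x y where "x \<in> P" "y \<in> P" "uncountable (P \<inter> {x..y})"
proof -
  obtain x where x: "x \<in> P" "uncountable (P \<inter> {x..})"
    using uncountable_split[OF P] by metis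
  have "P \<inter> {x..} \<subseteq> L" using P(1) by blast
  from uncountable_split[OF this x(2)] obtain y where "y \<in> P" "uncountable (P \<inter> {x..} \<inter> {..y})"
    by (metis IntD1)
  moreover have "P \<inter> {x..} \<inter> {..y} = P \<inter> {x..y}" by auto
  ultimately show ?thesis using that x(1) by metis
qed

text \<open>\<open>C n\<close> or its complement contains uncountably many points of
  \<open>Q\<close>. Both are order-convex, so an interval with end points in the chosen one stays
  inside it.\<close>

lemma uncountable_shrink:
  assumes Q: "Q \<subseteq> L" "uncountable Q"
  obtains x y where "x \<in> Q" "y \<in> Q" "uncountable (L \<inter> {x..y})" "{x..y} \<subseteq> C n \<or> {x..y} \<inter> C n = {}"
proof -
  have "uncountable (Q \<inter> C n) \<or> uncountable (Q - C n)"
    using Q(2) by (metis Int_Diff_Un countable_Un)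
  then show ?thesis
  proof
    assume u: "uncountable (Q \<inter> C n)"
    have sub: "Q \<inter> C n \<subseteq> L" using Q(1) by blast
    obtain x y where xy: "x \<in> Q \<inter> C n" "y \<in> Q \<inter> C n" "uncountable (Q \<inter> C n \<inter> {x..y})"
      using uncountable_interval[OF sub u] by metis
    have "uncountable (L \<inter> {x..y})"
      using xy(3) by (rule contrapos_nn, elim countable_subset[rotated]) (use Q(1) in auto)
    moreover have "{x..y} \<subseteq> C n" using lower xy(2) by auto
    ultimately show ?thesis using that xy by blast
  next
    assume u: "uncountable (Q - C n)"
    have sub: "Q - C n \<subseteq> L" using Q(1) by blast
    obtain x y where xy: "x \<in> Q - C n" "y \<in> Q - C n" "uncountable ((Q - C n) \<inter> {x..y})"
      using uncountable_interval[OF sub u] by metis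
    have "uncountable (L \<inter> {x..y})"
      using xy(3) by (rule contrapos_nn, elim countable_subset[rotated]) (use Q(1) in auto)
    moreover have "{x..y} \<inter> C n = {}" using lower xy(1) by auto
    ultimately show ?thesis using that xy by blast
  qed
qed

text \<open>The nodes of the Cantor scheme; an interval is coded by the pair of its end
  points.\<close>

definition fat :: "'a \<times> 'a \<Rightarrow> bool" where
  "fat p \<longleftrightarrow> uncountable (L \<inter> {fst p..snd p})"

text \<open>Splitting gives two uncountable parts, one below the other, and
  \<open>uncountable_shrink\<close> replaces each by an interval that \<open>C n\<close> does not
  cut. End points in \<open>Q\<close> keep the children inside the parent.\<close>

lemma fat_children:
  assumes "fat p"
  shows "\<exists>q r. fat q \<and> fat r \<and> {fst q..snd q} \<subseteq> {fst p..snd p} \<and> {fst r..snd r} \<subseteq> {fst p..snd p} \<and>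
    {fst q..snd q} \<inter> {fst r..snd r} = {} \<and>
    ({fst q..snd q} \<subseteq> C n \<or> {fst q..snd q} \<inter> C n = {}) \<and>
    ({fst r..snd r} \<subseteq> C n \<or> {fst r..snd r} \<inter> C n = {})"
proof -
  define Q where "Q = L \<inter> {fst p..snd p}"
  have Q: "Q \<subseteq> L" "uncountable Q" using assms by (auto simp: Q_def fat_def)
  obtain c c' where c: "c < c'" "uncountable (Q \<inter> {..c})" "uncountable (Q \<inter> {c'..})"
    using uncountable_split[OF Q] by metis
  have sub: "Q \<inter> {..c} \<subseteq> L" "Q \<inter> {c'..} \<subseteq> L" using Q(1) by auto
  obtain x y where xy: "x \<in> Q \<inter> {..c}" "y \<in> Q \<inter> {..c}" "uncountable (L \<inter> {x..y})"
    "{x..y} \<subseteq> C n \<or> {x..y} \<inter> C n = {}"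
    using uncountable_shrink[OF sub(1) c(2)] by metis
  obtain x' y' where xy': "x' \<in> Q \<inter> {c'..}" "y' \<in> Q \<inter> {c'..}" "uncountable (L \<inter> {x'..y'})"
    "{x'..y'} \<subseteq> C n \<or> {x'..y'} \<inter> C n = {}"
    using uncountable_shrink[OF sub(2) c(3)] by metis
  show ?thesis
    by (rule exI[of _ "(x, y)"], rule exI[of _ "(x', y')"])
      (use xy xy' c(1) in \<open>auto simp: fat_def Q_def\<close>)
qed

end

text \<open>A binary tree of intervals is built such that those at level \<open>Suc n\<close> are
  not cut by \<open>C n\<close>. Compactness puts a point of \<open>L\<close> on every branch, and
  the cuts leave only one.\<close>

theorem uncountable_compact_contains_cantor_set:
  fixes L :: "'a::linorder_topology set"
  assumes "compact L" "uncountable L" and "separating_cuts L C"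
  obtains S where "S \<subseteq> L" "S homeomorphic cantor_set"
proof -
  interpret separating_cuts L C by (rule assms(3))
  obtain x0 y0 where "uncountable (L \<inter> {x0..y0})"
    using uncountable_interval[OF subset_refl assms(2)] by metis
  then have root: "fat (x0, y0)" by (simp add: fat_def)
  define B where "B p = {fst p..snd p}" for p :: "'a \<times> 'a"
  define child where "child n p q r \<longleftrightarrow> fat q \<and> fat r \<and> B q \<subseteq> B p \<and> B r \<subseteq> B p \<and> B q \<inter> B r = {} \<and>
    (B q \<subseteq> C n \<or> B q \<inter> C n = {}) \<and> (B r \<subseteq> C n \<or> B r \<inter> C n = {})" for n p q r
  have ex: "\<exists>q r. child n p q r" if "fat p" for n p
    using fat_children[OF that, of n] unfolding child_def B_def .
  define q where "q n p = (SOME q. \<exists>r. child n p q r)" for n p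
  define r where "r n p = (SOME r. child n p (q n p) r)" for n p
  have "child n p (q n p) (r n p)" if "fat p" for n p
    using someI_ex[OF someI_ex[OF ex[OF that]]] unfolding q_def r_def .
  then have qr: "fat (q n p)" "fat (r n p)" "B (q n p) \<subseteq> B p" "B (r n p) \<subseteq> B p" "B (q n p) \<inter> B (r n p) = {}"
    "B (q n p) \<subseteq> C n \<or> B (q n p) \<inter> C n = {}" "B (r n p) \<subseteq> C n \<or> B (r n p) \<inter> C n = {}"
    if "fat p" for n p
    using that unfolding child_def by blast+
  \<comment> \<open>Bit \<open>n\<close> selects one of the two children of the node at level
    \<open>n\<close>, so \<open>J d n\<close> depends only on the first \<open>n\<close> bits of
    \<open>d\<close>.\<close>
  define J where "J d = rec_nat (x0, y0) (\<lambda>n p. if d n then r n p else q n p)" for d :: "nat \<Rightarrow> bool"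
  have J_0: "J d 0 = (x0, y0)" and J_Suc: "J d (Suc n) = (if d n then r n (J d n) else q n (J d n))" for d n
    by (simp_all add: J_def)
  have fat: "fat (J d n)" for d n
    by (induction n) (simp_all add: J_0 J_Suc root qr(1,2))
  have J_prefix: "J d' n = J d n" if "\<And>i. i < n \<Longrightarrow> d' i = d i" for d d' n
    using that by (induction n) (auto simp: J_0 J_Suc)
  have J_dec: "B (J d n) \<subseteq> B (J d m)" if "m \<le> n" for d m n
    using that by (rule lift_Suc_antimono_le[rotated]) (simp add: J_Suc qr(3,4)[OF fat])
  have J_cut: "B (J d (Suc n)) \<subseteq> C n \<or> B (J d (Suc n)) \<inter> C n = {}" for d n
    using qr(6,7)[OF fat[of d n], of n] by (simp add: J_Suc)
  have nonempty: "L \<inter> (\<Inter>n\<in>I. B (J d n)) \<noteq> {}" if fin: "finite I" for I d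
  proof -
    obtain N where N: "\<And>n. n \<in> I \<Longrightarrow> n \<le> N" using fin unfolding finite_nat_set_iff_bounded_le by blast
    have "L \<inter> B (J d N) \<noteq> {}" using fat[of d N] by (auto simp: fat_def B_def)
    moreover have "B (J d N) \<subseteq> (\<Inter>n\<in>I. B (J d n))" using J_dec N by blast
    ultimately show ?thesis by blast
  qed
  have closed_B: "closed (B p)" for p by (simp add: B_def)
  have "\<exists>x. x \<in> L \<and> (\<forall>n. x \<in> B (J d n))" for d
    using compact_imp_fip_image[OF assms(1), of UNIV "\<lambda>n. B (J d n)"] closed_B nonempty by auto
  then obtain \<pi> where \<pi>: "\<And>d. \<pi> d \<in> L" "\<And>d n. \<pi> d \<in> B (J d n)" by metis
  have unique: "x = \<pi> d" if x: "x \<in> L" "\<And>n. x \<in> B (J d n)" for x d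
  proof (rule ccontr)
    assume "x \<noteq> \<pi> d"
    then obtain n where "x \<in> C n \<and> \<pi> d \<notin> C n \<or> \<pi> d \<in> C n \<and> x \<notin> C n"
      using separates \<pi>(1)[of d] x(1) by (metis linorder_neqE)
    then show False using J_cut[of d n] x(2)[of "Suc n"] \<pi>(2)[of d "Suc n"] by blast
  qed
  have "inj \<pi>"
  proof (rule injI, rule ccontr)
    fix d d' assume eq: "\<pi> d = \<pi> d'" and "d \<noteq> d'"
    define n where "n = (LEAST n. d n \<noteq> d' n)"
    have "\<exists>n. d n \<noteq> d' n" using \<open>d \<noteq> d'\<close> by auto
    then have n: "d n \<noteq> d' n" unfolding n_def by (rule LeastI_ex)
    have "J d' n = J d n"
    proof (rule J_prefix)
      fix i assume "i < n"
      then have "\<not> d i \<noteq> d' i" unfolding n_def by (rule not_less_Least)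
      then show "d' i = d i" by simp
    qed
    then have "B (J d (Suc n)) \<inter> B (J d' (Suc n)) = {}"
      using qr(5)[OF fat[of d n], of n] n by (simp add: J_Suc Int_commute)
    then show False using \<pi>(2)[of d "Suc n"] \<pi>(2)[of d' "Suc n"] eq by auto
  qed
  have "continuous_on UNIV \<pi>"
  proof (rule continuous_on_bool_seq)
    fix d U assume U: "open U" "\<pi> d \<in> U"
    \<comment> \<open>Otherwise compactness of \<open>L - U\<close> would yield a second point of
      \<open>L\<close> on the branch.\<close>
    have "\<exists>n. L \<inter> B (J d n) \<subseteq> U"
    proof (rule ccontr)
      assume no: "\<not> ?thesis"
      have "(L - U) \<inter> (\<Inter>n\<in>UNIV. B (J d n)) \<noteq> {}"
      proof (rule compact_imp_fip_image)
        show "compact (L - U)" using assms(1) U(1) by (rule compact_diff)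
        fix I :: "nat set" assume "finite I"
        then obtain N where N: "\<And>n. n \<in> I \<Longrightarrow> n \<le> N"
          unfolding finite_nat_set_iff_bounded_le by blast
        then have "B (J d N) \<subseteq> (\<Inter>n\<in>I. B (J d n))" using J_dec by blast
        then show "(L - U) \<inter> (\<Inter>n\<in>I. B (J d n)) \<noteq> {}" using no by blast
      qed (rule closed_B)
      then obtain x where "x \<in> L" "x \<notin> U" "\<And>n. x \<in> B (J d n)" by auto
      then show False using unique U(2) by blast
    qed
    then obtain n where n: "L \<inter> B (J d n) \<subseteq> U" by blast
    have "\<pi> d' \<in> U" if d': "\<forall>i<n. d' i = d i" for d'
    proof -
      have "J d' n = J d n" by (rule J_prefix) (simp add: d')
      then show ?thesis using \<pi>(1)[of d'] \<pi>(2)[of d' n] n by auto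
    qed
    then show "\<exists>n. \<forall>d'. (\<forall>i<n. d' i = d i) \<longrightarrow> \<pi> d' \<in> U" by blast
  qed
  then have "(UNIV :: (nat \<Rightarrow> bool) set) homeomorphic range \<pi>"
    using \<open>inj \<pi>\<close> by (intro homeomorphic_compact[OF compact_UNIV_bool_seq]) auto
  then have "range \<pi> homeomorphic (UNIV :: (nat \<Rightarrow> bool) set)" by (rule homeomorphic_sym[THEN iffD1])
  then have "range \<pi> homeomorphic cantor_set"
    by (rule homeomorphic_trans[OF _ bool_seq_homeomorphic_cantor_set])
  moreover have "range \<pi> \<subseteq> L" using \<pi>(1) by blast
  ultimately show ?thesis by (rule that[rotated])
qed

section \<open>Jumps of continuous functions\<close>

text \<open>\<open>V\<close> is the intersection of a lower set whose part above \<open>x\<close>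
  lies in \<open>U\<close> and an upper set whose part below \<open>x\<close> lies in
  \<open>U\<close>. Each is an open ray, or the whole space if nothing lies beyond \<open>x\<close>
  on that side.\<close>

lemma order_convex_neighbourhood:
  fixes x :: "'a::linorder_topology"
  assumes "open U" "x \<in> U"
  obtains V where "open V" "x \<in> V" "V \<subseteq> U" "\<And>a b c. a \<in> V \<Longrightarrow> c \<in> V \<Longrightarrow> a \<le> b \<Longrightarrow> b \<le> c \<Longrightarrow> b \<in> V"
proof -
  obtain R where R: "open R" "x \<in> R" "\<And>a b. a \<in> R \<Longrightarrow> b \<le> a \<Longrightarrow> b \<in> R" "\<And>y. y \<in> R \<Longrightarrow> x \<le> y \<Longrightarrow> y \<in> U"
  proof (cases "\<exists>y. x < y")
    case True
    then obtain b where "x < b" "{x..<b} \<subseteq> U" using open_right[OF assms] by blast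
    then show ?thesis by (intro that[of "{..<b}"]) auto
  next
    case False
    then have "y \<in> U" if "x \<le> y" for y
      using that assms(2) by (metis order_le_less)
    then show ?thesis by (intro that[of UNIV]) auto
  qed
  obtain L where L: "open L" "x \<in> L" "\<And>a b. a \<in> L \<Longrightarrow> a \<le> b \<Longrightarrow> b \<in> L" "\<And>y. y \<in> L \<Longrightarrow> y \<le> x \<Longrightarrow> y \<in> U"
  proof (cases "\<exists>y. y < x")
    case True
    then obtain b where "b < x" "{b<..x} \<subseteq> U" using open_left[OF assms] by blast
    then show ?thesis by (intro that[of "{b<..}"]) auto
  next
    case False
    then have "y \<in> U" if "y \<le> x" for y
      using that assms(2) by (metis order_le_less)
    then show ?thesis by (intro that[of UNIV]) auto
  qed
  show ?thesis
  proof (rule that[of "R \<inter> L"])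
    show "R \<inter> L \<subseteq> U" using R(4) L(4) linear[of x] by blast
  qed (use R L in \<open>auto intro: open_Int\<close>)
qed

definition jump :: "'a::linorder set \<Rightarrow> 'a \<Rightarrow> 'a \<Rightarrow> bool" where
  "jump K a b \<longleftrightarrow> a \<in> K \<and> b \<in> K \<and> a < b \<and> {a<..<b} \<inter> K = {}"

lemma jump_unique: "jump K a b \<Longrightarrow> jump K a b' \<Longrightarrow> b = b'"
  unfolding jump_def by (metis IntI emptyE greaterThanLessThan_iff linorder_neqE)

text \<open>\<open>K\<close> is covered by finitely many order-convex neighbourhoods on which
  \<open>G\<close> varies by less than \<open>e\<close>. One that contains the left end
  \<open>a\<close> of a large jump omits the right end, so by convexity \<open>a\<close> is the
  maximum of \<open>K\<close> in it. Each neighbourhood thus accounts for at most one jump.\<close>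

lemma finite_large_jumps:
  fixes G :: "'a::linorder_topology \<Rightarrow> 'b::metric_space"
  assumes K: "compact K" and G: "continuous_on K G" and "e > 0"
  shows "finite {(a, b). jump K a b \<and> e \<le> dist (G a) (G b)}"
proof -
  define nb where "nb x V \<longleftrightarrow> open V \<and> x \<in> V \<and>
      (\<forall>a b c. a \<in> V \<longrightarrow> c \<in> V \<longrightarrow> a \<le> b \<longrightarrow> b \<le> c \<longrightarrow> b \<in> V) \<and>
      (\<forall>y\<in>K \<inter> V. dist (G y) (G x) < e / 2)" for x V
  have "\<exists>V. nb x V" if x: "x \<in> K" for x
  proof -
    obtain U where U: "open U" "x \<in> U" "\<And>y. y \<in> K \<Longrightarrow> y \<in> U \<Longrightarrow> G y \<in> ball (G x) (e / 2)"
      using G[unfolded continuous_on_topological, rule_format, OF x, of "ball (G x) (e / 2)"] \<open>e > 0\<close>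
      by auto
    obtain V where V: "open V" "x \<in> V" "V \<subseteq> U"
      "\<And>a b c. a \<in> V \<Longrightarrow> c \<in> V \<Longrightarrow> a \<le> b \<Longrightarrow> b \<le> c \<Longrightarrow> b \<in> V"
      by (rule order_convex_neighbourhood[OF U(1,2)]) (rule that)
    have "dist (G y) (G x) < e / 2" if "y \<in> K \<inter> V" for y
      using U(3)[of y] V(3) that by (auto simp: dist_commute)
    then show ?thesis using V(1,2,4) unfolding nb_def by blast
  qed
  then obtain V where "\<And>x. x \<in> K \<Longrightarrow> nb x (V x)" by metis
  then have V: "\<And>x. x \<in> K \<Longrightarrow> open (V x)" "\<And>x. x \<in> K \<Longrightarrow> x \<in> V x"
    "\<And>x a b c. x \<in> K \<Longrightarrow> a \<in> V x \<Longrightarrow> c \<in> V x \<Longrightarrow> a \<le> b \<Longrightarrow> b \<le> c \<Longrightarrow> b \<in> V x"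
    "\<And>x y. x \<in> K \<Longrightarrow> y \<in> K \<inter> V x \<Longrightarrow> dist (G y) (G x) < e / 2"
    unfolding nb_def by blast+
  have "K \<subseteq> (\<Union>x\<in>K. V x)" using V(2) by blast
  from compactE_image[OF K V(1) this] obtain D where D: "D \<subseteq> K" "finite D" "K \<subseteq> (\<Union>d\<in>D. V d)"
    by auto
  define S where "S = {(a, b). jump K a b \<and> e \<le> dist (G a) (G b)}"
  have "fst ` S \<subseteq> (\<Union>d\<in>D. {a \<in> K \<inter> V d. \<forall>y\<in>K \<inter> V d. y \<le> a})"
  proof
    fix a assume "a \<in> fst ` S"
    then obtain b where ab: "jump K a b" "e \<le> dist (G a) (G b)" by (auto simp: S_def)
    then have "a \<in> K" "b \<in> K" "a < b" by (auto simp: jump_def)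
    then obtain d where d: "d \<in> D" "a \<in> V d" using D(3) by blast
    then have "d \<in> K" using D(1) by blast
    have "b \<notin> V d"
    proof
      assume "b \<in> V d"
      from V(4)[OF \<open>d \<in> K\<close> IntI[OF \<open>a \<in> K\<close> d(2)]] V(4)[OF \<open>d \<in> K\<close> IntI[OF \<open>b \<in> K\<close> this]]
      have "dist (G a) (G b) < e" by (rule dist_triangle_half_l)
      then show False using ab(2) by simp
    qed
    have "y \<le> a" if y: "y \<in> K" "y \<in> V d" for y
    proof (rule ccontr)
      assume "\<not> y \<le> a"
      then have "b \<le> y" using ab(1) y(1) unfolding jump_def by (auto simp: disjoint_iff not_le)
      then have "b \<in> V d" using V(3)[OF \<open>d \<in> K\<close> d(2) y(2)] \<open>a < b\<close> by simp
      then show False using \<open>b \<notin> V d\<close> by simp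
    qed
    then show "a \<in> (\<Union>d\<in>D. {a \<in> K \<inter> V d. \<forall>y\<in>K \<inter> V d. y \<le> a})"
      using d \<open>a \<in> K\<close> by blast
  qed
  moreover have "finite (\<Union>d\<in>D. {a \<in> K \<inter> V d. \<forall>y\<in>K \<inter> V d. y \<le> a})"
  proof (intro finite_UN_I D(2) finite_if_subsingleton)
    fix d x y
    assume "x \<in> {a \<in> K \<inter> V d. \<forall>y\<in>K \<inter> V d. y \<le> a}" "y \<in> {a \<in> K \<inter> V d. \<forall>y\<in>K \<inter> V d. y \<le> a}"
    then have "x \<le> y" "y \<le> x" by blast+
    then show "x = y" by (rule order_antisym)
  qed
  ultimately have "finite (fst ` S)" by (rule finite_subset)
  moreover have "inj_on fst S"
    by (rule inj_onI) (auto simp: S_def dest: jump_unique)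
  ultimately show ?thesis unfolding S_def by (rule finite_imageD)
qed

text \<open>Only finitely many jumps have size at least 1/2, so \<open>c\<close> can avoid the real
  parts of their differences; smaller jumps stay below 1/2 anyway. The factor 3 leaves room for
  approximation errors of size \<open>\<eta>\<close>.\<close>

lemma jump_values_avoid:
  fixes G :: "'a::linorder_topology \<Rightarrow> complex"
  assumes K: "compact K" and G: "continuous_on K G"
  obtains c \<eta> where "1 / 2 < c" "c < 3 / 4" "0 < \<eta>" "\<eta> \<le> 1 / 8"
    "\<And>p q. p = q \<or> jump K p q \<or> jump K q p \<Longrightarrow> 3 * \<eta> \<le> \<bar>Re (G p - G q) - c\<bar>"
proof -
  define S where "S = {(a, b). jump K a b \<and> 1 / 2 \<le> dist (G a) (G b)}"
  define E where "E = (\<lambda>(a, b). Re (G a - G b)) ` S \<union> (\<lambda>(a, b). Re (G b - G a)) ` S"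
  have "finite S" unfolding S_def by (rule finite_large_jumps[OF K G]) simp
  then have "finite E" by (simp add: E_def)
  have "infinite ({1 / 2<..<3 / 4 :: real} - E)"
    using \<open>finite E\<close> infinite_Ioo[of "1 / 2" "3 / 4 :: real"] by simp
  from infinite_imp_nonempty[OF this] obtain c where "c \<in> {1 / 2<..<3 / 4} - E" by blast
  then have c: "1 / 2 < c" "c < 3 / 4" "c \<notin> E" by simp_all
  from finite_set_avoid[OF \<open>finite E\<close>, of c] obtain \<delta>
    where "\<delta> > 0" and "\<forall>v\<in>E. v \<noteq> c \<longrightarrow> \<delta> \<le> dist c v" by blast
  with c(3) have \<delta>: "\<delta> > 0" "\<And>v. v \<in> E \<Longrightarrow> \<delta> \<le> dist c v" by auto
  \<comment> \<open>\<open>\<delta>\<close> measures the distance of \<open>c\<close> from the large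
    jumps, \<open>c - 1 / 2\<close> that from the small ones.\<close>
  define \<eta> where "\<eta> = Min {\<delta>, c - 1 / 2, 1 / 8} / 3"
  have \<eta>: "3 * \<eta> \<le> \<delta>" "3 * \<eta> \<le> c - 1 / 2" "\<eta> \<le> 1 / 8" "\<eta> > 0"
    using \<delta>(1) c(1) by (auto simp: \<eta>_def min_def)
  have small: "3 * \<eta> \<le> \<bar>Re v - c\<bar>" if "cmod v < 1 / 2" for v
    using that abs_Re_le_cmod[of v] \<eta>(2) by linarith
  show ?thesis
  proof (rule that[OF c(1,2) \<eta>(4,3)])
    fix p q assume pq: "p = q \<or> jump K p q \<or> jump K q p"
    show "3 * \<eta> \<le> \<bar>Re (G p - G q) - c\<bar>"
    proof (cases "cmod (G p - G q) < 1 / 2")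
      case False
      then have "(p, q) \<in> S \<or> (q, p) \<in> S"
        using pq by (auto simp: S_def dist_norm norm_minus_commute)
      then have "Re (G p - G q) \<in> E" by (force simp: E_def)
      then show ?thesis using \<delta>(2)[of "Re (G p - G q)"] \<eta>(1) by (simp add: dist_real_def abs_minus_commute)
    qed (rule small)
  qed
qed

section \<open>Continuous functions compared along a distribution function\<close>

lemma compact_uniform_positive:
  fixes P :: "real \<Rightarrow> 'a::topological_space \<Rightarrow> bool"
  assumes S: "compact S"
    and local: "\<And>p. p \<in> S \<Longrightarrow> \<exists>U \<delta>. open U \<and> p \<in> U \<and> \<delta> > 0 \<and> (\<forall>q\<in>U \<inter> S. P \<delta> q)"
    and antimono: "\<And>\<delta> \<delta>' q. P \<delta> q \<Longrightarrow> \<delta>' \<le> \<delta> \<Longrightarrow> P \<delta>' q"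
  obtains \<delta> where "\<delta> > 0" "\<And>q. q \<in> S \<Longrightarrow> P \<delta> q"
proof -
  define nb where "nb p U \<delta> \<longleftrightarrow> open U \<and> p \<in> U \<and> \<delta> > 0 \<and> (\<forall>q\<in>U \<inter> S. P \<delta> q)" for p U \<delta>
  have "\<exists>U \<delta>. nb p U \<delta>" if "p \<in> S" for p
    using local[OF that] unfolding nb_def .
  then obtain U \<delta> where "\<And>p. p \<in> S \<Longrightarrow> nb p (U p) (\<delta> p)" by metis
  then have U: "\<And>p. p \<in> S \<Longrightarrow> open (U p)" "\<And>p. p \<in> S \<Longrightarrow> p \<in> U p" "\<And>p. p \<in> S \<Longrightarrow> \<delta> p > 0"
    "\<And>p q. p \<in> S \<Longrightarrow> q \<in> U p \<inter> S \<Longrightarrow> P (\<delta> p) q"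
    unfolding nb_def by blast+
  have "S \<subseteq> (\<Union>p\<in>S. U p)" using U(2) by blast
  from compactE_image[OF S U(1) this] obtain D where D: "D \<subseteq> S" "finite D" "S \<subseteq> (\<Union>d\<in>D. U d)"
    by auto
  \<comment> \<open>The minimum over the finite cover serves because \<open>P\<close> passes to
    smaller values; the entry 1 handles an empty cover.\<close>
  define \<epsilon> where "\<epsilon> = Min (insert 1 (\<delta> ` D))"
  show ?thesis
  proof (rule that[of \<epsilon>])
    show "\<epsilon> > 0" using D(1,2) U(3) by (auto simp: \<epsilon>_def)
    fix q assume "q \<in> S"
    then obtain d where d: "d \<in> D" "q \<in> U d" using D(3) by blast
    have "\<epsilon> \<le> \<delta> d" using D(2) d(1) by (simp add: \<epsilon>_def)
    moreover have "P (\<delta> d) q" using U(4)[of d q] d D(1) \<open>q \<in> S\<close> by blast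
    ultimately show "P \<epsilon> q" using antimono by blast
  qed
qed

text \<open>The function \<open>m\<close> is at most two-to-one on \<open>K\<close>, and identifies only the end points of jumps.\<close>

locale distribution_function =
  fixes K :: "'a::linorder_topology set" and m :: "'a \<Rightarrow> real"
  assumes compact_K: "compact K" and mono_m: "mono m"
    and strict: "\<And>a b c. b \<in> K \<Longrightarrow> a < b \<Longrightarrow> b < c \<Longrightarrow> m a < m c"
begin

text \<open>Near \<open>x\<close> the points of \<open>K\<close> are at most some
  \<open>t < z\<close>, near \<open>y\<close> they are at least some \<open>s > z\<close>.
  Strictness at \<open>z\<close> gives \<open>m t < m s\<close>, and the gap is
  \<open>\<delta>\<close>.\<close>

lemma m_separates:
  assumes "z \<in> K" "x < z" "z < y"
  obtains U V \<delta> where "open U" "x \<in> U" "open V" "y \<in> V" "\<delta> > 0"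
    "\<And>u v. u \<in> U \<inter> K \<Longrightarrow> v \<in> V \<inter> K \<Longrightarrow> m u + \<delta> \<le> m v"
proof -
  \<comment> \<open>If \<open>K\<close> has no point between \<open>x\<close> and \<open>z\<close>,
    its points below \<open>z\<close> are at most \<open>x\<close>, so \<open>t = x\<close> works;
    otherwise a point in between bounds a ray.\<close>
  obtain U t where U: "open U" "x \<in> U" "t < z" "\<And>u. u \<in> U \<inter> K \<Longrightarrow> u \<le> t"
  proof (cases "{x<..<z} \<inter> K = {}")
    case True
    then have "u \<le> x" if "u < z" "u \<in> K" for u
      using that by (metis disjoint_iff greaterThanLessThan_iff not_le)
    then show ?thesis using assms(2) by (intro that[of "{..<z}" x]) auto
  next
    case False
    then obtain u where "x < u" "u < z" by auto
    then show ?thesis by (intro that[of "{..<u}" u]) auto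
  qed
  obtain V s where V: "open V" "y \<in> V" "z < s" "\<And>v. v \<in> V \<inter> K \<Longrightarrow> s \<le> v"
  proof (cases "{z<..<y} \<inter> K = {}")
    case True
    then have "y \<le> v" if "z < v" "v \<in> K" for v
      using that by (metis disjoint_iff greaterThanLessThan_iff not_le)
    then show ?thesis using assms(3) by (intro that[of "{z<..}" y]) auto
  next
    case False
    then obtain v where "v < y" "z < v" by auto
    then show ?thesis by (intro that[of "{v<..}" v]) auto
  qed
  show ?thesis
  proof (rule that[OF U(1,2) V(1,2), of "m s - m t"])
    show "m s - m t > 0" using strict[OF assms(1) U(3) V(3)] by simp
    show "m u + (m s - m t) \<le> m v" if "u \<in> U \<inter> K" "v \<in> V \<inter> K" for u v
      using monoD[OF mono_m U(4)[OF that(1)]] monoD[OF mono_m V(4)[OF that(2)]] by simp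
  qed
qed

text \<open>Uniform continuity up to jumps, for the pseudometric given by \<open>m\<close>. Near an
  equal or jumping pair, that pair serves as \<open>p\<close> and \<open>q\<close>; near any other
  pair, a point of \<open>K\<close> in between keeps the values of \<open>m\<close> apart.
  Compactness of \<open>K \<times> K\<close> makes \<open>\<delta>\<close> uniform.\<close>

lemma modulus:
  fixes G :: "'a \<Rightarrow> complex"
  assumes G: "continuous_on K G" and "\<eta> > 0"
  obtains \<delta> where "\<delta> > 0" "\<And>x y. x \<in> K \<Longrightarrow> y \<in> K \<Longrightarrow> \<bar>m x - m y\<bar> < \<delta> \<Longrightarrow>
    \<exists>p q. (p = q \<or> jump K p q \<or> jump K q p) \<and> cmod ((G x - G y) - (G p - G q)) < \<eta>"
proof -
  define near where "near x y \<longleftrightarrow> (\<exists>p q. (p = q \<or> jump K p q \<or> jump K q p) \<and>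
    cmod ((G x - G y) - (G p - G q)) < \<eta>)" for x y
  define P where "P \<delta> xy \<longleftrightarrow> (\<bar>m (fst xy) - m (snd xy)\<bar> < \<delta> \<longrightarrow> near (fst xy) (snd xy))" for \<delta> xy
  have local: "\<exists>U \<delta>. open U \<and> xy \<in> U \<and> \<delta> > 0 \<and> (\<forall>q\<in>U \<inter> K \<times> K. P \<delta> q)" if "xy \<in> K \<times> K" for xy
  proof -
    obtain x y where xy: "xy = (x, y)" "x \<in> K" "y \<in> K" using \<open>xy \<in> K \<times> K\<close> by blast
    consider "x = y \<or> jump K x y \<or> jump K y x" | z where "z \<in> K" "x < z" "z < y"
      | z where "z \<in> K" "y < z" "z < x"
      using xy(2,3) unfolding jump_def
      by (cases x y rule: linorder_cases) (auto simp: disjoint_iff)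
    then show ?thesis
    proof cases
      case 1
      have nb: "\<exists>U. open U \<and> x \<in> U \<and> (\<forall>u\<in>U \<inter> K. cmod (G u - G x) < \<eta> / 2)" if "x \<in> K" for x
        using G[unfolded continuous_on_topological, rule_format, OF that, of "ball (G x) (\<eta> / 2)"] \<open>\<eta> > 0\<close>
        by (auto simp: dist_norm norm_minus_commute)
      obtain U where U: "open U" "x \<in> U" "\<And>u. u \<in> U \<inter> K \<Longrightarrow> cmod (G u - G x) < \<eta> / 2"
        using nb[OF xy(2)] by blast
      obtain V where V: "open V" "y \<in> V" "\<And>u. u \<in> V \<inter> K \<Longrightarrow> cmod (G u - G y) < \<eta> / 2"
        using nb[OF xy(3)] by blast
      have "near u v" if "u \<in> U \<inter> K" "v \<in> V \<inter> K" for u v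
      proof -
        have "cmod ((G u - G x) - (G v - G y)) < \<eta>"
          using norm_triangle_ineq4[of "G u - G x" "G v - G y"] U(3)[OF that(1)] V(3)[OF that(2)] by simp
        then have "cmod ((G u - G v) - (G x - G y)) < \<eta>" by (simp add: algebra_simps)
        then show ?thesis unfolding near_def using 1 by blast
      qed
      then have "\<forall>q\<in>U \<times> V \<inter> K \<times> K. P 1 q" by (auto simp: P_def)
      then show ?thesis
        using open_Times[OF U(1) V(1)] U(2) V(2) by (intro exI[of _ "U \<times> V"] exI[of _ 1]) (simp add: xy)
    next
      case (2 z)
      obtain U V \<delta> where *: "open U" "x \<in> U" "open V" "y \<in> V" "\<delta> > 0"
        "\<And>u v. u \<in> U \<inter> K \<Longrightarrow> v \<in> V \<inter> K \<Longrightarrow> m u + \<delta> \<le> m v"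
        by (rule m_separates[OF 2]) (rule that)
      have PP: "P \<delta> (u, v)" if "u \<in> U \<inter> K" "v \<in> V \<inter> K" for u v
        using *(6)[OF that] unfolding P_def by (auto simp: abs_if)
      have "P \<delta> q" if "q \<in> U \<times> V \<inter> K \<times> K" for q
        using PP[of "fst q" "snd q"] that by (simp add: mem_Times_iff)
      then show ?thesis
        using open_Times[OF *(1,3)] *(2,4,5) by (intro exI[of _ "U \<times> V"] exI[of _ \<delta>]) (simp add: xy)
    next
      case (3 z)
      obtain U V \<delta> where *: "open U" "y \<in> U" "open V" "x \<in> V" "\<delta> > 0"
        "\<And>u v. u \<in> U \<inter> K \<Longrightarrow> v \<in> V \<inter> K \<Longrightarrow> m u + \<delta> \<le> m v"
        by (rule m_separates[OF 3]) (rule that)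
      have PP: "P \<delta> (v, u)" if "u \<in> U \<inter> K" "v \<in> V \<inter> K" for u v
        using *(6)[OF that] unfolding P_def by (auto simp: abs_if)
      have "P \<delta> q" if "q \<in> V \<times> U \<inter> K \<times> K" for q
        using PP[of "snd q" "fst q"] that by (simp add: mem_Times_iff)
      then show ?thesis
        using open_Times[OF *(3,1)] *(2,4,5) by (intro exI[of _ "V \<times> U"] exI[of _ \<delta>]) (simp add: xy)
    qed
  qed
  have anti: "P \<delta>' q" if "P \<delta> q" "\<delta>' \<le> \<delta>" for \<delta> \<delta>' q
    using that unfolding P_def by linarith
  obtain \<delta> where \<delta>: "\<delta> > 0" "\<And>q. q \<in> K \<times> K \<Longrightarrow> P \<delta> q"
    by (rule compact_uniform_positive[of "K \<times> K" P, OF compact_Times[OF compact_K compact_K]])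
      (erule local, erule anti, assumption, rule that)
  show ?thesis
  proof (rule that[OF \<delta>(1)])
    fix x y assume "x \<in> K" "y \<in> K" "\<bar>m x - m y\<bar> < \<delta>"
    then have "near x y" using \<delta>(2)[of "(x, y)"] by (simp add: P_def)
    then show "\<exists>p q. (p = q \<or> jump K p q \<or> jump K q p) \<and> cmod ((G x - G y) - (G p - G q)) < \<eta>"
      unfolding near_def .
  qed
qed

text \<open>The points up to \<open>a\<close> where \<open>G\<close> has modulus at least
  \<open>\<eta>\<close> form a compact set; its maximum \<open>e\<close>, if any, lies below
  \<open>a\<close>. Strictness at \<open>a\<close>, between \<open>e\<close> and \<open>b\<close>,
  gives \<open>m e < m b\<close>, so \<open>\<delta> = t - m e\<close> is positive.\<close>

lemma left_continuity_at_jump: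
  fixes G :: "'a \<Rightarrow> complex"
  assumes G: "continuous_on K G" and "\<eta> > 0" and ab: "jump K a b" "m b \<le> t" and "G a = 0"
  obtains \<delta> where "\<delta> > 0" "\<And>x. x \<in> K \<Longrightarrow> x \<le> a \<Longrightarrow> t - \<delta> < m x \<Longrightarrow> cmod (G x) < \<eta>"
proof -
  define Z where "Z = {x \<in> K \<inter> {..a}. \<eta> \<le> cmod (G x)}"
  show ?thesis
  proof (cases "Z = {}")
    case True
    then show ?thesis by (intro that[of 1]) (auto simp: Z_def not_le)
  next
    case False
    have "compact Z"
    proof -
      have c: "compact (K \<inter> {..a})" using compact_K by (rule compact_Int_closed) simp
      have "continuous_on (K \<inter> {..a}) (\<lambda>x. cmod (G x))"
        by (intro continuous_on_norm continuous_on_subset[OF G]) simp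
      then have "closed ((\<lambda>x. cmod (G x)) -` {\<eta>..} \<inter> (K \<inter> {..a}))"
        using continuous_on_closed_vimage[OF compact_imp_closed[OF c]] closed_atLeast by blast
      from compact_Int_closed[OF c this] show ?thesis
        by (rule back_subst[of compact]) (auto simp: Z_def)
    qed
    then obtain e where e: "e \<in> Z" "\<And>x. x \<in> Z \<Longrightarrow> x \<le> e"
      using compact_attains_sup[OF _ False] by blast
    have "e \<noteq> a" using e(1) \<open>G a = 0\<close> \<open>\<eta> > 0\<close> by (auto simp: Z_def)
    then have "e < a" using e(1) by (auto simp: Z_def)
    then have "m e < t" using strict[of a e b] ab by (auto simp: jump_def)
    show ?thesis
    proof (rule that[of "t - m e"])
      fix x assume x: "x \<in> K" "x \<le> a" "t - (t - m e) < m x"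
      then have "x \<notin> Z" using e(2)[of x] monoD[OF mono_m, of x e] by auto
      then show "cmod (G x) < \<eta>" using x by (auto simp: Z_def)
    qed (use \<open>m e < t\<close> in simp)
  qed
qed

text \<open>\<open>s\<close> and \<open>t\<close> are chosen by a pigeonhole argument such that the graphs of \<open>G s\<close> and \<open>G t\<close> over
  the values of \<open>m\<close> are close to each other. Then \<open>G s x - G t x\<close> is close to a
  difference \<open>G s x - G s y\<close> with \<open>m y\<close> close to \<open>m x\<close>, hence to \<open>0\<close> or to a jump of \<open>G s\<close>.\<close>

lemma jump_family_difference:
  fixes G :: "real \<Rightarrow> 'a \<Rightarrow> complex"
  assumes T: "uncountable T"
    and jump: "\<And>t. t \<in> T \<Longrightarrow> jump K (a t) (b t)" "\<And>t. t \<in> T \<Longrightarrow> m (a t) = t" "\<And>t. t \<in> T \<Longrightarrow> m (b t) = t"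
    and G: "\<And>t. t \<in> T \<Longrightarrow> continuous_on K (G t)" "\<And>t. t \<in> T \<Longrightarrow> G t (a t) = 0" "\<And>t. t \<in> T \<Longrightarrow> G t (b t) = 1"
  obtains s t c x where "s \<in> T" "t \<in> T" "1 / 2 < c" "x \<in> K" "c < Re (G s x - G t x)"
    "\<And>x. x \<in> K \<Longrightarrow> Re (G s x - G t x) \<noteq> c"
proof -
  \<comment> \<open>\<open>1 / real (Suc N)\<close> is a common scale for all the smallness
    conditions on \<open>G t\<close>. There are countably many \<open>N\<close>, so uncountably many
    \<open>t\<close> share one.\<close>
  define good where "good t N \<longleftrightarrow> (\<exists>c \<eta>. 1 / 2 < c \<and> c < 3 / 4 \<and> 1 / real (Suc N) \<le> \<eta> \<and>
      (\<forall>p q. p = q \<or> jump K p q \<or> jump K q p \<longrightarrow> 3 * \<eta> \<le> \<bar>Re (G t p - G t q) - c\<bar>) \<and>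
      (\<forall>x\<in>K. \<forall>y\<in>K. \<bar>m x - m y\<bar> < 1 / real (Suc N) \<longrightarrow>
        (\<exists>p q. (p = q \<or> jump K p q \<or> jump K q p) \<and> cmod ((G t x - G t y) - (G t p - G t q)) < \<eta>))) \<and>
      (\<forall>x\<in>K. x \<le> a t \<longrightarrow> t - 1 / real (Suc N) < m x \<longrightarrow> cmod (G t x) < 1 / 8)" for t N
  have ex_good: "\<exists>N. good t N" if t: "t \<in> T" for t
  proof -
    obtain c \<eta> where c: "1 / 2 < c" "c < 3 / 4" "0 < \<eta>" "\<eta> \<le> 1 / 8"
      "\<And>p q. p = q \<or> jump K p q \<or> jump K q p \<Longrightarrow> 3 * \<eta> \<le> \<bar>Re (G t p - G t q) - c\<bar>"
      by (rule jump_values_avoid[OF compact_K G(1)[OF t]]) (rule that)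
    obtain \<delta> where \<delta>: "\<delta> > 0" "\<And>x y. x \<in> K \<Longrightarrow> y \<in> K \<Longrightarrow> \<bar>m x - m y\<bar> < \<delta> \<Longrightarrow>
      \<exists>p q. (p = q \<or> jump K p q \<or> jump K q p) \<and> cmod ((G t x - G t y) - (G t p - G t q)) < \<eta>"
      by (rule modulus[OF G(1)[OF t] c(3)]) (rule that)
    obtain \<epsilon> where \<epsilon>: "\<epsilon> > 0" "\<And>x. x \<in> K \<Longrightarrow> x \<le> a t \<Longrightarrow> t - \<epsilon> < m x \<Longrightarrow> cmod (G t x) < 1 / 8"
      by (rule left_continuity_at_jump[OF G(1)[OF t] _ jump(1)[OF t] eq_refl[OF jump(3)[OF t]] G(2)[OF t], of "1 / 8"])
        (simp, rule that)
    have "Min {\<eta>, \<delta>, \<epsilon>} > 0" using c(3) \<delta>(1) \<epsilon>(1) by simp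
    then obtain N where "inverse (real (Suc N)) < Min {\<eta>, \<delta>, \<epsilon>}" using reals_Archimedean by blast
    then have N: "1 / real (Suc N) < \<eta>" "1 / real (Suc N) < \<delta>" "1 / real (Suc N) < \<epsilon>"
      by (simp_all add: inverse_eq_divide)
    have 1: "\<forall>p q. p = q \<or> jump K p q \<or> jump K q p \<longrightarrow> 3 * \<eta> \<le> \<bar>Re (G t p - G t q) - c\<bar>"
      using c(5) by blast
    have 2: "\<forall>x\<in>K. \<forall>y\<in>K. \<bar>m x - m y\<bar> < 1 / real (Suc N) \<longrightarrow>
        (\<exists>p q. (p = q \<or> jump K p q \<or> jump K q p) \<and> cmod ((G t x - G t y) - (G t p - G t q)) < \<eta>)"
      using \<delta>(2) order_less_trans[OF _ N(2)] by blast
    have 3: "\<forall>x\<in>K. x \<le> a t \<longrightarrow> t - 1 / real (Suc N) < m x \<longrightarrow> cmod (G t x) < 1 / 8"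
    proof (intro ballI impI)
      fix x assume "x \<in> K" "x \<le> a t" "t - 1 / real (Suc N) < m x"
      then show "cmod (G t x) < 1 / 8" using \<epsilon>(2)[of x] N(3) by linarith
    qed
    show ?thesis
      unfolding good_def
      by (rule exI[of _ N], intro conjI exI[of _ c] exI[of _ \<eta>]) (use c(1,2) N(1) 1 2 3 in simp_all)
  qed
  have "T \<subseteq> (\<Union>N. {t \<in> T. good t N})" using ex_good by blast
  then have "\<exists>N. uncountable {t \<in> T. good t N}"
    using T by (meson countable_UN countable_subset countableI_type)
  then obtain N where unc: "uncountable {t \<in> T. good t N}" ..
  define n where "n = real (Suc N)"
  have n: "n > 0" by (simp add: n_def)
  \<comment> \<open>\<open>cell t x\<close> names the grid box of side \<open>1 / n\<close> that
    contains the graph point \<open>(m x, G t x)\<close>; \<open>code t\<close> records the occupied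
    boxes and \<open>t\<close> itself up to \<open>1 / n\<close>. By boundedness only countably many
    codes occur.\<close>
  define cell where "cell t x = (\<lfloor>n * m x\<rfloor>, \<lfloor>n * Re (G t x)\<rfloor>, \<lfloor>n * Im (G t x)\<rfloor>)" for t x
  define code where "code t = (\<lfloor>n * t\<rfloor>, cell t ` K)" for t
  have finite_cells: "finite (cell t ` K)" if t: "t \<in> T" for t
  proof -
    have "K \<noteq> {}" using jump(1)[OF t] by (auto simp: jump_def)
    obtain x0 where x0: "x0 \<in> K" "\<And>x. x \<in> K \<Longrightarrow> x0 \<le> x"
      using compact_attains_inf[OF compact_K \<open>K \<noteq> {}\<close>] by blast
    obtain x1 where x1: "x1 \<in> K" "\<And>x. x \<in> K \<Longrightarrow> x \<le> x1"
      using compact_attains_sup[OF compact_K \<open>K \<noteq> {}\<close>] by blast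
    have "bounded (G t ` K)"
      using compact_continuous_image[OF G(1)[OF t] compact_K] by (rule compact_imp_bounded)
    then obtain B where B: "\<And>x. x \<in> K \<Longrightarrow> cmod (G t x) \<le> B"
      by (auto simp: bounded_iff)
    have "cell t ` K \<subseteq> {\<lfloor>n * m x0\<rfloor>..\<lfloor>n * m x1\<rfloor>} \<times> {\<lfloor>n * - B\<rfloor>..\<lfloor>n * B\<rfloor>} \<times> {\<lfloor>n * - B\<rfloor>..\<lfloor>n * B\<rfloor>}"
    proof
      fix z assume "z \<in> cell t ` K"
      then obtain x where x: "x \<in> K" "z = cell t x" by blast
      have "m x0 \<le> m x" "m x \<le> m x1" using x0(2)[OF x(1)] x1(2)[OF x(1)] mono_m by (auto dest: monoD)
      moreover have "- B \<le> Re (G t x)" "Re (G t x) \<le> B" "- B \<le> Im (G t x)" "Im (G t x) \<le> B"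
        using B[OF x(1)] abs_Re_le_cmod[of "G t x"] abs_Im_le_cmod[of "G t x"] by linarith+
      ultimately show "z \<in> {\<lfloor>n * m x0\<rfloor>..\<lfloor>n * m x1\<rfloor>} \<times> {\<lfloor>n * - B\<rfloor>..\<lfloor>n * B\<rfloor>} \<times> {\<lfloor>n * - B\<rfloor>..\<lfloor>n * B\<rfloor>}"
        unfolding x(2) cell_def mem_Times_iff fst_conv snd_conv atLeastAtMost_iff
        by (intro conjI floor_mono mult_left_mono) (use n in simp_all)
    qed
    then show ?thesis by (rule finite_subset) simp
  qed
  have "countable (code ` {t \<in> T. good t N})"
  proof (rule countable_subset)
    show "code ` {t \<in> T. good t N} \<subseteq> UNIV \<times> Collect finite"
      using finite_cells by (auto simp: code_def)
    show "countable ((UNIV :: int set) \<times> (Collect finite :: (int \<times> int \<times> int) set set))"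
      by (intro countable_SIGMA countable_Collect_finite) simp
  qed
  then have "\<not> inj_on code {t \<in> T. good t N}"
    using unc countable_image_inj_on by blast
  then obtain s0 t0 where st0: "s0 \<in> T" "t0 \<in> T" "good s0 N" "good t0 N" "code s0 = code t0" "s0 \<noteq> t0"
    unfolding inj_on_def by blast
  obtain s t where st: "s \<in> T" "t \<in> T" "good s N" "good t N" "code s = code t" "s < t"
  proof (cases "s0 < t0")
    case True then show ?thesis using st0 by (intro that[of s0 t0])
  next
    case False then show ?thesis using st0 by (intro that[of t0 s0]) simp_all
  qed
  have floor_close: "\<bar>u - v\<bar> < 1 / n" if "\<lfloor>n * u\<rfloor> = \<lfloor>n * v\<rfloor>" for u v :: real
  proof -
    have "\<bar>n * u - n * v\<bar> < 1" using that by linarith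
    then have "n * \<bar>u - v\<bar> < 1" using n by (simp add: abs_mult right_diff_distrib[symmetric])
    then show ?thesis using n by (simp add: field_simps)
  qed
  from \<open>good s N\<close>[unfolded good_def] obtain c \<eta> where cs: "1 / 2 < c \<and> c < 3 / 4 \<and> 1 / real (Suc N) \<le> \<eta> \<and>
      (\<forall>p q. p = q \<or> jump K p q \<or> jump K q p \<longrightarrow> 3 * \<eta> \<le> \<bar>Re (G s p - G s q) - c\<bar>) \<and>
      (\<forall>x\<in>K. \<forall>y\<in>K. \<bar>m x - m y\<bar> < 1 / real (Suc N) \<longrightarrow>
        (\<exists>p q. (p = q \<or> jump K p q \<or> jump K q p) \<and> cmod ((G s x - G s y) - (G s p - G s q)) < \<eta>))"
    by (elim conjE[of "Ex _"] exE)
  then have c: "1 / 2 < c" "c < 3 / 4" "1 / n \<le> \<eta>"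
      "\<And>p q. p = q \<or> jump K p q \<or> jump K q p \<Longrightarrow> 3 * \<eta> \<le> \<bar>Re (G s p - G s q) - c\<bar>"
      "\<And>x y. x \<in> K \<Longrightarrow> y \<in> K \<Longrightarrow> \<bar>m x - m y\<bar> < 1 / n \<Longrightarrow>
        \<exists>p q. (p = q \<or> jump K p q \<or> jump K q p) \<and> cmod ((G s x - G s y) - (G s p - G s q)) < \<eta>"
    unfolding n_def by blast+
  \<comment> \<open>A box shared by both graphs provides \<open>y\<close> with \<open>G s y\<close>
    near \<open>G t x\<close>. Then \<open>c\<close> would be within \<open>2 * \<eta>\<close> of
    \<open>0\<close> or of a jump of \<open>G s\<close>.\<close>
  have avoid: "Re (G s x - G t x) \<noteq> c" if x: "x \<in> K" for x
  proof
    assume eq: "Re (G s x - G t x) = c"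
    have "cell t x \<in> cell s ` K" using st(5) x by (auto simp: code_def)
    then obtain y where y: "y \<in> K" "cell t x = cell s y" by blast
    then have close: "\<bar>m x - m y\<bar> < 1 / n" "\<bar>Re (G t x) - Re (G s y)\<bar> < 1 / n"
      by (auto simp: cell_def intro: floor_close)
    obtain p q where pq: "p = q \<or> jump K p q \<or> jump K q p" "cmod ((G s x - G s y) - (G s p - G s q)) < \<eta>"
      using c(5)[OF x y(1) close(1)] by blast
    have "\<bar>Re (G s x - G s y) - Re (G s p - G s q)\<bar> < \<eta>"
      using abs_Re_le_cmod[of "(G s x - G s y) - (G s p - G s q)"] pq(2) by simp
    then have "\<bar>Re (G s p - G s q) - c\<bar> < 3 * \<eta>"
      using close(2) eq c(3) by simp
    then show False using c(4)[OF pq(1)] by simp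
  qed
  have "t - s < 1 / n"
    using floor_close[of t s] st(5,6) by (simp add: code_def)
  have bs: "b s \<in> K" using jump(1)[OF st(1)] by (simp add: jump_def)
  \<comment> \<open>The jump with the smaller index lies to the left, and \<open>m (b s) = s\<close>
    is close to \<open>t\<close>. So \<open>G t\<close> is small at \<open>b s\<close>, where
    \<open>G s\<close> is 1.\<close>
  have "b s \<le> a t"
  proof (rule ccontr)
    assume "\<not> b s \<le> a t"
    then have "m (a t) \<le> m (b s)" by (intro monoD[OF mono_m]) simp
    then show False using jump(2)[OF st(2)] jump(3)[OF st(1)] st(6) by simp
  qed
  moreover have "t - 1 / n < m (b s)" using \<open>t - s < 1 / n\<close> jump(3)[OF st(1)] by simp
  ultimately have "cmod (G t (b s)) < 1 / 8"
    using \<open>good t N\<close> bs unfolding good_def n_def by blast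
  then have "c < Re (G s (b s) - G t (b s))"
    using G(3)[OF st(1)] abs_Re_le_cmod[of "G t (b s)"] c(2) by simp
  then show ?thesis using that[OF st(1,2) c(1) bs _ avoid] by blast
qed

lemma m_eq_imp_jump:
  assumes "x \<in> K" "y \<in> K" "x < y" "m x = m y"
  shows "jump K x y"
proof -
  have "z \<notin> K" if "x < z" "z < y" for z
    using strict[of z x y] that assms(4) by auto
  then show ?thesis using assms(1-3) by (auto simp: jump_def)
qed

text \<open>Sublevel sets of \<open>m\<close> at rationals separate points with different values.
  Points with equal values form a jump, and the rays \<open>{..a}\<close> for the countably many
  left ends \<open>a\<close> separate these.\<close>

lemma separating_cuts_if_countable:
  assumes "L \<subseteq> K" and countable: "countable {a \<in> L. \<exists>b\<in>L. jump K a b \<and> m a = m b}" (is "countable ?A")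
  obtains C where "separating_cuts L C"
proof -
  define \<C> where "\<C> = (\<lambda>q. {x. m x < q}) ` \<rat> \<union> (\<lambda>a. {..a}) ` ?A"
  have \<C>: "countable \<C>" "\<C> \<noteq> {}"
    using countable countable_rat by (auto simp: \<C>_def)
  have "separating_cuts L (from_nat_into \<C>)"
  proof
    fix n x y assume y: "y \<in> from_nat_into \<C> n" and xy: "x \<le> y"
    have "from_nat_into \<C> n \<in> \<C>" by (rule from_nat_into[OF \<C>(2)])
    then consider q where "from_nat_into \<C> n = {x. m x < q}" | a where "from_nat_into \<C> n = {..a}"
      unfolding \<C>_def by blast
    then show "x \<in> from_nat_into \<C> n"
    proof cases
      case 1 then show ?thesis using y monoD[OF mono_m xy] by simp
    next
      case 2 then show ?thesis using y xy by simp
    qed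
  next
    fix x y assume xy: "x \<in> L" "y \<in> L" "x < y"
    have "\<exists>C\<in>\<C>. x \<in> C \<and> y \<notin> C"
    proof (cases "m x = m y")
      case True
      then have "jump K x y" using m_eq_imp_jump[of x y] xy assms(1) by blast
      then have "x \<in> ?A" using True xy(1,2) by blast
      then have "{..x} \<in> \<C>" unfolding \<C>_def by blast
      then show ?thesis using xy(3) by (intro bexI[of _ "{..x}"]) auto
    next
      case False
      then have "m x < m y" using monoD[OF mono_m less_imp_le[OF xy(3)]] by (simp add: less_le)
      from Rats_dense_in_real[OF this] obtain q where q: "q \<in> \<rat>" "m x < q" "q < m y" by blast
      then have "{x. m x < q} \<in> \<C>" unfolding \<C>_def by blast
      then show ?thesis using q by (intro bexI[of _ "{x. m x < q}"]) auto
    qed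
    then obtain C where C: "C \<in> \<C>" "x \<in> C" "y \<notin> C" by blast
    obtain n where "from_nat_into \<C> n = C" using from_nat_into_surj[OF \<C>(1) C(1)] by blast
    then show "\<exists>n. x \<in> from_nat_into \<C> n \<and> y \<notin> from_nat_into \<C> n" using C(2,3) by blast
  qed
  then show ?thesis by (rule that)
qed

lemma uncountable_jumps:
  assumes "L \<subseteq> K" "compact L" "uncountable L" and no_cantor: "\<not> (\<exists>S::'a set. S homeomorphic cantor_set)"
  shows "uncountable {a \<in> L. \<exists>b\<in>L. jump K a b \<and> m a = m b}"
proof
  assume "countable {a \<in> L. \<exists>b\<in>L. jump K a b \<and> m a = m b}"
  from separating_cuts_if_countable[OF assms(1) this] obtain C where C: "separating_cuts L C" .
  obtain S where "S \<subseteq> L" "S homeomorphic cantor_set"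
    by (rule uncountable_compact_contains_cantor_set[OF assms(2,3) C]) (rule that)
  then show False using no_cantor by blast
qed

text \<open>If \<open>x < a\<close> are left ends and \<open>b\<close> is the right end at
  \<open>a\<close>, strictness at \<open>a\<close> gives \<open>m x < m b = m a\<close>. The jumps
  can thus be indexed by real numbers.\<close>

lemma inj_on_m_jumps: "inj_on m {a \<in> L. \<exists>b\<in>L. jump K a b \<and> m a = m b}"
proof (rule inj_onI)
  fix x a
  assume "x \<in> {a \<in> L. \<exists>b\<in>L. jump K a b \<and> m a = m b}" "a \<in> {a \<in> L. \<exists>b\<in>L. jump K a b \<and> m a = m b}"
    and eq: "m x = m a"
  then obtain y b where j: "jump K x y" "m x = m y" "jump K a b" "m a = m b" by blast
  show "x = a"
  proof (rule linorder_cases[of x a])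
    assume "x < a"
    then show ?thesis using strict[of a x b] j eq by (simp add: jump_def)
  next
    assume "a < x"
    then show ?thesis using strict[of x a y] j eq by (simp add: jump_def)
  qed
qed

end

section \<open>Function algebras and the Shilov boundary\<close>

locale function_algebra =
  fixes X :: "'x topology" and \<A> :: "('x \<Rightarrow> complex) set"
  assumes compact_X: "compact_space X"
    and nonempty_X: "topspace X \<noteq> {}"
    and closed_subalgebra: "closed_subalgebra X \<A>"
begin

text \<open>Elements of \<open>\<A>\<close> are extensional, whereas \<open>alg F\<close> ignores
  the values of \<open>F\<close> off the space, so pointwise formulas need no restriction.\<close>

definition alg :: "('x \<Rightarrow> complex) \<Rightarrow> bool" where
  "alg F \<longleftrightarrow> restrict F (topspace X) \<in> \<A>"

lemma alg_cong:
  assumes "alg F" "\<And>x. x \<in> topspace X \<Longrightarrow> F x = G x"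
  shows "alg G"
proof -
  have "restrict F (topspace X) = restrict G (topspace X)"
    using assms(2) by auto
  then show ?thesis using assms(1) by (simp add: alg_def)
qed

lemma alg_const: "alg (\<lambda>x. c)"
  using closed_subalgebra unfolding closed_subalgebra_def alg_def by blast

lemma alg_add:
  assumes "alg F" "alg G" shows "alg (\<lambda>x. F x + G x)"
proof -
  have "(\<lambda>x\<in>topspace X. restrict F (topspace X) x + restrict G (topspace X) x) \<in> \<A>"
    using closed_subalgebra assms unfolding closed_subalgebra_def alg_def by blast
  moreover have "(\<lambda>x\<in>topspace X. restrict F (topspace X) x + restrict G (topspace X) x)
      = (\<lambda>x\<in>topspace X. F x + G x)" by auto
  ultimately show ?thesis unfolding alg_def by metis
qed

lemma alg_mult:
  assumes "alg F" "alg G" shows "alg (\<lambda>x. F x * G x)"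
proof -
  have "(\<lambda>x\<in>topspace X. restrict F (topspace X) x * restrict G (topspace X) x) \<in> \<A>"
    using closed_subalgebra assms unfolding closed_subalgebra_def alg_def by blast
  moreover have "(\<lambda>x\<in>topspace X. restrict F (topspace X) x * restrict G (topspace X) x)
      = (\<lambda>x\<in>topspace X. F x * G x)" by auto
  ultimately show ?thesis unfolding alg_def by metis
qed

lemma alg_cmult: "alg F \<Longrightarrow> alg (\<lambda>x. c * F x)"
  by (rule alg_mult[OF alg_const])

lemma alg_divide_const: "alg F \<Longrightarrow> alg (\<lambda>x. F x / c)"
  using alg_cmult[of F "inverse c"] by (simp add: field_simps)

lemma alg_diff: "alg F \<Longrightarrow> alg G \<Longrightarrow> alg (\<lambda>x. F x - G x)"
  using alg_add[OF _ alg_cmult[of G "-1"]] by simp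

lemma alg_power: "alg F \<Longrightarrow> alg (\<lambda>x. F x ^ n)"
  by (induction n) (auto intro: alg_const alg_mult)

lemma alg_sum: "(\<And>i. i \<in> I \<Longrightarrow> alg (F i)) \<Longrightarrow> alg (\<lambda>x. \<Sum>i\<in>I. F i x)"
  by (induction I rule: infinite_finite_induct) (auto intro: alg_const alg_add)

lemma in_mspace:
  assumes "f \<in> \<A>" shows "f \<in> mspace (C_space X)"
proof -
  have "\<A> \<subseteq> mspace (C_space X)"
    using closed_subalgebra closedin_subset unfolding closed_subalgebra_def
    by (metis topspace_mtopology_of)
  then show ?thesis using assms by blast
qed

lemma alg_restrict_eq: "f \<in> \<A> \<Longrightarrow> restrict f (topspace X) = f"
  using in_mspace[of f] by (simp add: extensional_restrict)

lemma algI: "f \<in> \<A> \<Longrightarrow> alg f"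
  by (simp add: alg_def alg_restrict_eq)

lemma alg_continuous:
  assumes "alg F" shows "continuous_map X euclidean F"
proof -
  have "continuous_map X euclidean (restrict F (topspace X))"
    using in_mspace assms unfolding alg_def by force
  then show ?thesis by (rule continuous_map_eq) auto
qed

lemma alg_bounded:
  assumes "alg F"
  obtains B where "B > 0" "\<And>x. x \<in> topspace X \<Longrightarrow> cmod (F x) \<le> B"
proof -
  have "compact (F ` topspace X)"
    using image_compactin[OF _ alg_continuous[OF assms]] compact_X
    by (auto simp: compact_space_def)
  from bounded_pos[THEN iffD1, OF compact_imp_bounded[OF this]]
  show ?thesis using that by auto
qed

lemma alg_separates:
  assumes "x \<in> topspace X" "y \<in> topspace X" "x \<noteq> y"
  obtains F where "alg F" "F x \<noteq> F y"
  using closed_subalgebra assms algI unfolding closed_subalgebra_def by blast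

text \<open>A uniform limit is continuous, so its restriction is an element of C(X) in the closure
  of the closed set \<open>\<A>\<close>.\<close>

lemma alg_limit:
  assumes lim: "\<And>e. e > 0 \<Longrightarrow> \<exists>G. alg G \<and> (\<forall>x\<in>topspace X. cmod (F x - G x) \<le> e)"
  shows "alg F"
proof -
  obtain G where G: "\<And>n. alg (G n)" "\<And>n x. x \<in> topspace X \<Longrightarrow> cmod (F x - G n x) \<le> 1 / Suc n"
  proof -
    have "\<forall>n. \<exists>G. alg G \<and> (\<forall>x\<in>topspace X. cmod (F x - G x) \<le> 1 / Suc n)"
      using lim by simp
    then show ?thesis using that by metis
  qed
  have ev: "\<forall>\<^sub>F n in sequentially. 1 / real (Suc n) < e" if "e > 0" for e
    using order_tendstoD(2)[OF LIMSEQ_inverse_real_of_nat that] by (simp add: inverse_eq_divide)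
  have cF: "continuous_map X euclidean F"
  proof -
    have "continuous_map X Met_TC.mtopology F"
    proof (rule Met_TC.continuous_map_uniform_limit[where F=sequentially and f=G])
      show "\<forall>\<^sub>F n in sequentially. \<forall>x\<in>topspace X. F x \<in> UNIV \<and> dist (G n x) (F x) < e"
        if "e > 0" for e
        using ev[OF that] by eventually_elim
          (metis G(2) UNIV_I dist_commute dist_norm order.strict_trans1)
    qed (use alg_continuous G in auto)
    then show ?thesis by simp
  qed
  define f where "f = restrict F (topspace X)"
  have cpt: "compactin X (topspace X)" using compact_X by (simp add: compact_space_def)
  have fm: "f \<in> mspace (C_space X)"
  proof -
    have 1: "continuous_map X euclidean f"
      using cF unfolding f_def by (rule continuous_map_eq) auto
    moreover have "bounded (f ` topspace X)"
      using image_compactin[OF cpt 1] by (auto intro: compact_imp_bounded)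
    ultimately show ?thesis by (auto simp: f_def)
  qed
  interpret C: Metric_space "mspace (C_space X)" "mdist (C_space X)"
    by (rule Metric_space_mspace_mdist)
  have "f \<in> C.mtopology closure_of \<A>"
    unfolding C.metric_closure_of_alt
  proof (intro CollectI conjI fm allI impI)
    fix r :: real assume "r > 0"
    from lim[OF this] obtain H where H: "alg H" "\<And>x. x \<in> topspace X \<Longrightarrow> cmod (F x - H x) \<le> r"
      by blast
    define h where "h = restrict H (topspace X)"
    have h: "h \<in> \<A>" using H(1) by (simp add: alg_def h_def)
    have "mdist (C_space X) f h \<le> r"
      unfolding cfunspace_mdist_le[OF fm in_mspace[OF h] nonempty_X]
      by (auto simp: f_def h_def dist_norm H(2))
    then have "h \<in> C.mcball f r"
      using fm in_mspace[OF h] by (simp only: C.in_mcball simp_thms)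
    then show "\<exists>y\<in>\<A>. y \<in> C.mcball f r"
      using h by blast
  qed
  moreover have "closedin C.mtopology \<A>"
    using closed_subalgebra unfolding closed_subalgebra_def by (simp add: mtopology_of_def)
  ultimately show ?thesis
    unfolding alg_def f_def by (simp add: closure_of_closedin)
qed


section \<open>Inverses, signs and idempotents in the algebra\<close>

lemma alg_neumann:
  assumes w: "alg w" and le: "\<And>x. x \<in> topspace X \<Longrightarrow> cmod (w x) \<le> \<rho>" and "\<rho> < 1"
  shows "alg (\<lambda>x. 1 / (1 - w x))"
proof (rule alg_limit)
  fix e :: real assume "e > 0"
  have "\<rho> \<ge> 0"
    using nonempty_X le norm_ge_zero order_trans by blast
  then have "(\<lambda>n. \<rho> ^ n / (1 - \<rho>)) \<longlonglongrightarrow> 0 / (1 - \<rho>)"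
    using \<open>\<rho> < 1\<close> by (intro tendsto_intros LIMSEQ_realpow_zero) auto
  then have "\<forall>\<^sub>F n in sequentially. \<rho> ^ n / (1 - \<rho>) < e"
    using \<open>e > 0\<close> by (auto dest: order_tendstoD(2))
  then obtain n where n: "\<rho> ^ n / (1 - \<rho>) < e"
    by (auto simp: eventually_sequentially)
  have "cmod (1 / (1 - w x) - (\<Sum>i<n. w x ^ i)) \<le> e" if x: "x \<in> topspace X" for x
  proof -
    have "w x \<noteq> 1" using le[OF x] \<open>\<rho> < 1\<close> by auto
    then have "1 / (1 - w x) - (\<Sum>i<n. w x ^ i) = w x ^ n / (1 - w x)"
      using one_diff_power_eq[of "w x" n] by (simp add: field_simps)
    moreover have "cmod (w x ^ n / (1 - w x)) \<le> \<rho> ^ n / (1 - \<rho>)"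
    proof -
      have "1 - \<rho> \<le> cmod (1 - w x)"
        using norm_triangle_ineq2[of 1 "w x"] le[OF x] by simp
      then show ?thesis
        using \<open>\<rho> < 1\<close> \<open>\<rho> \<ge> 0\<close> le[OF x]
        by (auto simp: norm_divide norm_power intro!: frac_le power_mono)
    qed
    ultimately show ?thesis using n by simp
  qed
  then show "\<exists>G. alg G \<and> (\<forall>x\<in>topspace X. cmod (1 / (1 - w x) - G x) \<le> e)"
    using alg_sum[of "{..<n}" "\<lambda>i x. w x ^ i"] alg_power[OF w] by blast
qed

lemma Re_bounded_away:
  assumes g: "alg g" and nz: "\<And>x. x \<in> topspace X \<Longrightarrow> Re (g x) \<noteq> 0"
  obtains d where "d > 0" "\<And>x. x \<in> topspace X \<Longrightarrow> d \<le> \<bar>Re (g x)\<bar>"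
proof -
  have c: "compact (g ` topspace X)"
    using image_compactin[OF _ alg_continuous[OF g]] compact_X
    by (auto simp: compact_space_def)
  have "\<exists>z\<in>g ` topspace X. \<forall>y\<in>g ` topspace X. \<bar>Re z\<bar> \<le> \<bar>Re y\<bar>"
    by (rule continuous_attains_inf[OF c]) (use nonempty_X in \<open>auto intro!: continuous_intros\<close>)
  then obtain x where "x \<in> topspace X" "\<And>y. y \<in> topspace X \<Longrightarrow> \<bar>Re (g x)\<bar> \<le> \<bar>Re (g y)\<bar>"
    by auto
  then show ?thesis using that[of "\<bar>Re (g x)\<bar>"] nz by auto
qed

text \<open>The inverse of \<open>g + \<i> t\<close> exists in the algebra for large \<open>t\<close>; it is continued to \<open>t = 0\<close> in steps
  short enough for the Neumann series to converge.\<close>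

lemma alg_inverse:
  assumes g: "alg g" and nz: "\<And>x. x \<in> topspace X \<Longrightarrow> Re (g x) \<noteq> 0"
  shows "alg (\<lambda>x. 1 / g x)"
proof -
  obtain d where d: "d > 0" "\<And>x. x \<in> topspace X \<Longrightarrow> d \<le> \<bar>Re (g x)\<bar>"
    using Re_bounded_away[OF g nz] by blast
  obtain B where B: "B > 0" "\<And>x. x \<in> topspace X \<Longrightarrow> cmod (g x) \<le> B"
    using alg_bounded[OF g] by blast
  define P where "P t = alg (\<lambda>x. 1 / (g x + \<i> * of_real t))" for t :: real
  \<comment> \<open>Factoring out \<open>\<i> * of_real t\<close> leaves 1 plus a term of modulus at
    most 1/2.\<close>
  have large: "P t" if t: "2 * B \<le> t" for t
  proof -
    have "t > 0" using t B(1) by simp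
    have "alg (\<lambda>x. 1 / (1 - g x / (- \<i> * of_real t)))"
    proof (rule alg_neumann)
      show "cmod (g x / (- \<i> * of_real t)) \<le> 1 / 2" if "x \<in> topspace X" for x
        using B(2)[OF that] t \<open>t > 0\<close> by (simp add: norm_divide norm_mult field_simps)
      show "alg (\<lambda>x. g x / (- \<i> * of_real t))" by (rule alg_divide_const[OF g])
    qed simp
    from alg_divide_const[OF this, of "\<i> * of_real t"] show ?thesis
      unfolding P_def
    proof (rule alg_cong)
      fix x
      have "1 - g x / (- \<i> * of_real t) = (g x + \<i> * of_real t) / (\<i> * of_real t)"
        using \<open>t > 0\<close> by (simp add: add_divide_distrib)
      then show "1 / (1 - g x / (- \<i> * of_real t)) / (\<i> * of_real t) = 1 / (g x + \<i> * of_real t)"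
        using \<open>t > 0\<close> by simp
    qed
  qed
  \<comment> \<open>The real part keeps \<open>g + \<i> * r\<close> at distance at least
    \<open>d\<close> from 0 for every real \<open>r\<close>, so the step length \<open>d / 2\<close>
    works at each stage.\<close>
  have step: "P s" if t: "P t" and st: "\<bar>t - s\<bar> \<le> d / 2" for s t
  proof -
    define w where "w x = \<i> * of_real (t - s) * (1 / (g x + \<i> * of_real t))" for x
    have nz': "d \<le> cmod (g x + \<i> * of_real r)" if "x \<in> topspace X" for x r
      using d(2)[OF that] abs_Re_le_cmod[of "g x + \<i> * of_real r"] by simp
    have "alg (\<lambda>x. 1 / (1 - w x))"
    proof (rule alg_neumann)
      show "cmod (w x) \<le> 1 / 2" if "x \<in> topspace X" for x
      proof -
        have "\<bar>t - s\<bar> / cmod (g x + \<i> * of_real t) \<le> (d / 2) / d"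
          using nz'[OF that] d(1) st by (intro frac_le) auto
        then show ?thesis
          using d(1) unfolding w_def norm_mult norm_divide norm_of_real by simp
      qed
      show "alg w" unfolding w_def using t unfolding P_def by (rule alg_cmult)
    qed simp
    from alg_mult[OF t[unfolded P_def] this] show ?thesis
      unfolding P_def
    proof (rule alg_cong)
      fix x assume x: "x \<in> topspace X"
      have 1: "g x + \<i> * of_real t \<noteq> 0" "g x + \<i> * of_real s \<noteq> 0"
        using nz'[OF x] d(1) by (metis norm_zero not_le)+
      have "(g x + \<i> * of_real t) * (1 - w x) = g x + \<i> * of_real s"
        using 1 by (simp add: w_def field_simps)
      then show "1 / (g x + \<i> * of_real t) * (1 / (1 - w x)) = 1 / (g x + \<i> * of_real s)"
        by simp
    qed
  qed
  obtain n :: nat where n: "2 * B \<le> n * (d / 2)"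
    using reals_Archimedean3[of "d / 2"] d(1) by (metis half_gt_zero less_imp_le)
  \<comment> \<open>The descent starts beyond \<open>2 * B\<close>; truncated subtraction keeps it
    at 0 once \<open>j\<close> reaches \<open>n\<close>.\<close>
  have "P (real (n - j) * (d / 2))" for j
  proof (induction j)
    case 0
    show ?case using large[OF n] by simp
  next
    case (Suc j)
    show ?case
      by (rule step[OF Suc]) (use d(1) in \<open>auto simp: of_nat_diff algebra_simps abs_if not_less_eq_eq
          Suc_diff_Suc[symmetric] split: if_splits\<close>, cases "j < n"; auto simp: of_nat_diff algebra_simps)
  qed
  from this[of n] show ?thesis by (simp add: P_def)
qed

text \<open>Newton's iteration for the equation \<open>z\<^sup>2 = 1\<close> preserves both half planes, and under the Cayley
  transform \<open>(z - s) / (z + s)\<close> it becomes squaring.\<close>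

primrec newton_sgn :: "nat \<Rightarrow> complex \<Rightarrow> complex" where
  "newton_sgn 0 z = z"
| "newton_sgn (Suc n) z = (newton_sgn n z + 1 / newton_sgn n z) / 2"

text \<open>\<open>u\<close> and \<open>1 / u\<close> have real parts of the same sign, which
  averaging preserves.\<close>

lemma sgn_Re_newton_sgn:
  assumes "Re z \<noteq> 0"
  shows "sgn (Re (newton_sgn n z)) = sgn (Re z)"
proof (induction n)
  case (Suc n)
  define u where "u = newton_sgn n z"
  have u: "Re u \<noteq> 0" using Suc assms by (auto simp: u_def sgn_if split: if_splits)
  have "Re (1 / u) = Re u / (cmod u)\<^sup>2" by (simp add: Re_divide cmod_power2)
  then have "Re (newton_sgn (Suc n) z) = Re u * ((1 + 1 / (cmod u)\<^sup>2) / 2)"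
    by (simp add: u_def[symmetric] field_simps)
  moreover have "(1 + 1 / (cmod u)\<^sup>2) / 2 > 0" by (simp add: add_pos_nonneg)
  ultimately have "sgn (Re (newton_sgn (Suc n) z)) = sgn (Re u)"
    by (simp only: sgn_mult sgn_pos mult_1_right)
  then show ?case using Suc by (simp only: u_def)
qed simp

text \<open>Squaring the Cayley transform \<open>n\<close> times produces the exponent
  \<open>2 ^ n\<close>; multiplying out avoids the quotient by \<open>z + s\<close>.\<close>

lemma newton_sgn_ratio:
  fixes s :: real
  assumes "Re z \<noteq> 0" "s = sgn (Re z)" "cmod (z - s) \<le> \<rho> * cmod (z + s)" "\<rho> \<ge> 0"
  shows "cmod (newton_sgn n z - s) \<le> \<rho> ^ 2 ^ n * cmod (newton_sgn n z + s)"
proof (induction n)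
  case 0 then show ?case using assms by simp
next
  case (Suc n)
  define u where "u = newton_sgn n z"
  have u: "u \<noteq> 0" using sgn_Re_newton_sgn[OF assms(1), of n] assms(1)
    by (auto simp: u_def sgn_if split: if_splits)
  have s: "complex_of_real s * s = 1" using assms(1,2) by (auto simp: sgn_if)
  have 1: "newton_sgn (Suc n) z - s = (u - s)\<^sup>2 / (2 * u)"
    using u s by (simp add: u_def[symmetric] field_simps power2_eq_square)
  have 2: "newton_sgn (Suc n) z + s = (u + s)\<^sup>2 / (2 * u)"
    using u s by (simp add: u_def[symmetric] field_simps power2_eq_square)
  have "(cmod (u - s))\<^sup>2 \<le> (\<rho> ^ 2 ^ n * cmod (u + s))\<^sup>2"
    using Suc by (intro power_mono) (auto simp: u_def)
  also have "\<dots> = \<rho> ^ 2 ^ Suc n * (cmod (u + s))\<^sup>2"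
    by (simp add: power_mult_distrib power_mult[symmetric] mult.commute)
  finally show ?case
    unfolding 1 2 norm_divide norm_power using u by (simp add: divide_right_mono)
qed

text \<open>The Newton iterates stay in the algebra because their real parts never vanish.
  Compactness bounds the initial Cayley ratio by some \<open>\<rho> < 1\<close>, so the convergence
  is uniform.\<close>

lemma alg_sgn_Re:
  assumes g: "alg g" and nz: "\<And>x. x \<in> topspace X \<Longrightarrow> Re (g x) \<noteq> 0"
  shows "alg (\<lambda>x. of_real (sgn (Re (g x))))"
proof (rule alg_limit)
  fix e :: real assume "e > 0"
  obtain d where d: "d > 0" "\<And>x. x \<in> topspace X \<Longrightarrow> d \<le> \<bar>Re (g x)\<bar>"
    using Re_bounded_away[OF g nz] by blast
  obtain B where B: "B > 0" "\<And>x. x \<in> topspace X \<Longrightarrow> cmod (g x) \<le> B"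
    using alg_bounded[OF g] by blast
  \<comment> \<open>\<open>q\<close> comes from \<open>(cmod (z - s))\<^sup>2 = (cmod (z +
    s))\<^sup>2 - 4 * \<bar>Re z\<bar>\<close> with \<open>d \<le> \<bar>Re z\<bar>\<close> and
    \<open>cmod (z + s) \<le> B + 1\<close>.\<close>
  define q where "q = 1 - 4 * d / (B + 1)\<^sup>2"
  define \<rho> where "\<rho> = sqrt (max 0 q)"
  have "q < 1" using d B by (simp add: q_def)
  then have \<rho>: "0 \<le> \<rho>" "\<rho> < 1" by (auto simp: \<rho>_def)
  have ratio: "cmod (g x - sgn (Re (g x))) \<le> \<rho> * cmod (g x + sgn (Re (g x)))"
    if x: "x \<in> topspace X" for x
  proof -
    define s where "s = sgn (Re (g x))"
    have s: "s * s = 1" "s * Re (g x) = \<bar>Re (g x)\<bar>" "\<bar>s\<bar> = 1"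
      using nz[OF x] by (auto simp: s_def sgn_if)
    have eq: "(cmod (g x - s))\<^sup>2 = (cmod (g x + s))\<^sup>2 - 4 * \<bar>Re (g x)\<bar>"
      unfolding cmod_power2 using s(2) by (simp add: power2_eq_square algebra_simps)
    have "cmod (g x + s) \<le> B + 1"
      using norm_triangle_ineq[of "g x" s] B(2)[OF x] s(3) by simp
    then have "(cmod (g x + s))\<^sup>2 \<le> (B + 1)\<^sup>2" by (intro power_mono) auto
    then have "4 * d / (B + 1)\<^sup>2 * (cmod (g x + s))\<^sup>2 \<le> 4 * d / (B + 1)\<^sup>2 * (B + 1)\<^sup>2"
      using d(1) by (intro mult_left_mono) auto
    then have "4 * d / (B + 1)\<^sup>2 * (cmod (g x + s))\<^sup>2 \<le> 4 * d"
      using B(1) by simp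
    then have "(cmod (g x - s))\<^sup>2 \<le> q * (cmod (g x + s))\<^sup>2"
      unfolding eq q_def left_diff_distrib using d(2)[OF x] by simp
    also have "\<dots> \<le> max 0 q * (cmod (g x + s))\<^sup>2"
      by (intro mult_right_mono) auto
    also have "\<dots> = (\<rho> * cmod (g x + s))\<^sup>2"
      by (simp add: \<rho>_def power_mult_distrib)
    finally show ?thesis
      unfolding s_def[symmetric] by (rule power2_le_imp_le) (use \<rho>(1) in simp)
  qed
  have alg_newton: "alg (\<lambda>x. newton_sgn n (g x))" for n
  proof (induction n)
    case (Suc n)
    have "Re (newton_sgn n (g x)) \<noteq> 0" if "x \<in> topspace X" for x
      using sgn_Re_newton_sgn[OF nz[OF that], of n] nz[OF that] by (metis sgn_0_0)
    then show ?case
      using alg_divide_const[OF alg_add[OF Suc alg_inverse[OF Suc]], of 2] by simp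
  qed (simp add: g)
  \<comment> \<open>The bound 1/2 turns \<open>cmod (u - s) \<le> r * (cmod (u - s) + 2)\<close>
    into \<open>cmod (u - s) \<le> 4 * r\<close>, and \<open>e / 4\<close> makes this at most
    \<open>e\<close>.\<close>
  define r where "r = min (1 / 2) (e / 4)"
  have "r > 0" using \<open>e > 0\<close> by (simp add: r_def)
  then obtain n where n: "\<rho> ^ n < r" using real_arch_pow_inv[OF _ \<rho>(2)] by blast
  have "\<rho> ^ 2 ^ n \<le> \<rho> ^ n"
    using \<rho> by (intro power_decreasing) (auto simp: less_imp_le)
  then have n': "\<rho> ^ 2 ^ n \<le> r" using n by simp
  have "cmod (of_real (sgn (Re (g x))) - newton_sgn n (g x)) \<le> e" if x: "x \<in> topspace X" for x
  proof -
    define s where "s = sgn (Re (g x))"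
    define u where "u = newton_sgn n (g x)"
    have s: "\<bar>s\<bar> = 1" using nz[OF x] by (auto simp: s_def sgn_if)
    have "cmod (u - s) \<le> \<rho> ^ 2 ^ n * cmod (u + s)"
      unfolding u_def by (rule newton_sgn_ratio[OF nz[OF x] s_def ratio[OF x, folded s_def] \<rho>(1)])
    also have "\<dots> \<le> r * cmod (u + s)" using n' by (intro mult_right_mono) auto
    also have "\<dots> \<le> r * (cmod (u - s) + 2)"
    proof -
      have "cmod (u + s) \<le> cmod (u - s) + cmod (2 * of_real s)"
        using norm_triangle_ineq[of "u - s" "2 * of_real s"] by (simp add: add.commute)
      then show ?thesis using \<open>r > 0\<close> s by (simp add: norm_mult)
    qed
    finally have "cmod (u - s) * (1 - r) \<le> 2 * r" by (simp add: algebra_simps)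
    moreover have "cmod (u - s) * (1 / 2) \<le> cmod (u - s) * (1 - r)"
      by (intro mult_left_mono) (auto simp: r_def)
    ultimately have "cmod (u - s) \<le> 4 * r" by simp
    also have "\<dots> \<le> e" by (simp add: r_def)
    finally show ?thesis by (simp add: u_def s_def norm_minus_commute)
  qed
  then show "\<exists>G. alg G \<and> (\<forall>x\<in>topspace X. cmod (of_real (sgn (Re (g x))) - G x) \<le> e)"
    using alg_newton by blast
qed

text \<open>If \<open>c\<close> were omitted, \<open>(sgn (Re g - c) + 1) / 2\<close> would be an
  idempotent of the algebra with value 0 at \<open>x\<close> and 1 at \<open>y\<close>.\<close>

lemma idempotents_trivial_Re:
  assumes triv: "idempotents_trivial X \<A>" and g: "alg g"
    and x: "x \<in> topspace X" "Re (g x) < c" and y: "y \<in> topspace X" "c < Re (g y)"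
  shows "\<exists>z\<in>topspace X. Re (g z) = c"
proof (rule ccontr)
  assume no: "\<not> ?thesis"
  then have "alg (\<lambda>z. of_real (sgn (Re (g z - of_real c))))"
    using alg_sgn_Re[OF alg_diff[OF g alg_const[of "of_real c"]]] by simp
  then have 1: "alg (\<lambda>z. (of_real (sgn (Re (g z - of_real c))) + 1) / 2)" (is "alg ?h")
    by (intro alg_divide_const alg_add alg_const)
  define f where "f = restrict ?h (topspace X)"
  have "f \<in> \<A>" using 1 by (simp add: alg_def f_def)
  moreover have "(\<lambda>z\<in>topspace X. (f z)\<^sup>2) = f"
    using no by (auto simp: f_def sgn_if fun_eq_iff)
  ultimately have "f = (\<lambda>x\<in>topspace X. 0) \<or> f = (\<lambda>x\<in>topspace X. 1)"
    using triv unfolding idempotents_trivial_def by blast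
  moreover have "f x = 0" "f y = 1" using x y by (auto simp: f_def)
  ultimately show False using x y by auto
qed

section \<open>Existence of the Shilov boundary\<close>

lemma openin_alg_preimage:
  assumes "alg F" "open V" shows "openin X {x \<in> topspace X. F x \<in> V}"
  using openin_continuous_map_preimage[OF alg_continuous[OF assms(1)], of V] assms(2) by simp

lemma closedin_alg_preimage:
  assumes "alg F" "closed V" shows "closedin X {x \<in> topspace X. F x \<in> V}"
  using closedin_continuous_map_preimage[OF alg_continuous[OF assms(1)], of V] assms(2) by simp

lemma compactin_if_closedin: "closedin X C \<Longrightarrow> compactin X C"
  using compact_X closedin_compact_space by blast

lemma alg_attains_max:
  assumes "alg F" "closedin X H" "H \<noteq> {}"
  obtains y where "y \<in> H" "\<And>x. x \<in> H \<Longrightarrow> cmod (F x) \<le> cmod (F y)"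
proof -
  have "compact (F ` H)"
    using image_compactin[OF compactin_if_closedin[OF assms(2)] alg_continuous[OF assms(1)]] by simp
  then have "\<exists>z\<in>F ` H. \<forall>y\<in>F ` H. cmod y \<le> cmod z"
    by (rule continuous_attains_sup) (use assms(3) in \<open>auto intro!: continuous_intros\<close>)
  then show ?thesis using that by auto
qed

text \<open>The maximum modulus is attained on nonempty closed sets, so equality of suprema becomes
  pointwise domination.\<close>

lemma is_boundary_iff:
  "is_boundary X \<A> H \<longleftrightarrow>
     closedin X H \<and> (\<forall>F. alg F \<longrightarrow> (\<forall>x\<in>topspace X. \<exists>y\<in>H. cmod (F x) \<le> cmod (F y)))"
proof (intro iffI conjI allI impI ballI)
  assume H: "is_boundary X \<A> H"
  then show cl: "closedin X H" by (simp add: is_boundary_def)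
  have eq: "(SUP x\<in>H. ennreal (cmod (F x))) = (SUP x\<in>topspace X. ennreal (cmod (F x)))"
    if "alg F" for F
  proof -
    have "(SUP x\<in>H. ennreal (cmod (F x))) = (SUP x\<in>H. ennreal (cmod (restrict F (topspace X) x)))"
      using closedin_subset[OF cl] by (intro SUP_cong) auto
    also have "\<dots> = (SUP x\<in>topspace X. ennreal (cmod (restrict F (topspace X) x)))"
      using H that unfolding is_boundary_def alg_def by blast
    also have "\<dots> = (SUP x\<in>topspace X. ennreal (cmod (F x)))"
      by (intro SUP_cong) auto
    finally show ?thesis .
  qed
  \<comment> \<open>The supremum over the empty set is 0, which the constant function 1 rules
    out.\<close>
  have "H \<noteq> {}"
    using eq[OF alg_const[of 1]] nonempty_X by (auto simp: bot_ennreal)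
  fix F x assume F: "alg F" and x: "x \<in> topspace X"
  obtain y where y: "y \<in> H" "\<And>x. x \<in> H \<Longrightarrow> cmod (F x) \<le> cmod (F y)"
    using alg_attains_max[OF F cl \<open>H \<noteq> {}\<close>] by blast
  have "ennreal (cmod (F x)) \<le> (SUP x\<in>H. ennreal (cmod (F x)))"
    unfolding eq[OF F] using x by (rule SUP_upper)
  also have "\<dots> \<le> ennreal (cmod (F y))"
    using y(2) by (intro SUP_least ennreal_leI)
  finally show "\<exists>y\<in>H. cmod (F x) \<le> cmod (F y)" using y(1) by auto
next
  assume *: "closedin X H \<and> (\<forall>F. alg F \<longrightarrow> (\<forall>x\<in>topspace X. \<exists>y\<in>H. cmod (F x) \<le> cmod (F y)))"
  show "is_boundary X \<A> H" unfolding is_boundary_def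
  proof (intro conjI ballI antisym)
    fix f assume "f \<in> \<A>"
    show "(SUP x\<in>H. ennreal (cmod (f x))) \<le> (SUP x\<in>topspace X. ennreal (cmod (f x)))"
      using * closedin_subset by (intro SUP_subset_mono) auto
    show "(SUP x\<in>topspace X. ennreal (cmod (f x))) \<le> (SUP x\<in>H. ennreal (cmod (f x)))"
    proof (rule SUP_mono)
      fix x assume "x \<in> topspace X"
      then show "\<exists>y\<in>H. ennreal (cmod (f x)) \<le> ennreal (cmod (f y))"
        using * algI[OF \<open>f \<in> \<A>\<close>] by (meson ennreal_leI)
    qed
  qed (use * in blast)
qed

lemma openin_basic_neighbourhood:
  assumes "finite Fs" "\<And>F. F \<in> Fs \<Longrightarrow> alg F"
  shows "openin X {y \<in> topspace X. \<forall>F\<in>Fs. cmod (F y) < 1}"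
  using assms
proof (induction Fs)
  case (insert F Fs)
  have "{y \<in> topspace X. \<forall>G\<in>insert F Fs. cmod (G y) < 1}
      = {y \<in> topspace X. F y \<in> ball 0 1} \<inter> {y \<in> topspace X. \<forall>G\<in>Fs. cmod (G y) < 1}" by auto
  also have "openin X \<dots>" using insert by (intro openin_Int openin_alg_preimage) auto
  finally show ?case .
qed simp

text \<open>The algebra separates \<open>x\<close> from each point of the compact complement of
  \<open>W\<close>, so finitely many functions suffice. Scaling to the value 2 makes the modulus
  exceed 1 on a whole neighbourhood.\<close>

lemma basic_neighbourhood:
  assumes W: "openin X W" "x \<in> W"
  obtains Fs where "finite Fs" "\<And>F. F \<in> Fs \<Longrightarrow> alg F" "\<And>F. F \<in> Fs \<Longrightarrow> F x = 0"
    "\<And>y. y \<in> topspace X \<Longrightarrow> (\<And>F. F \<in> Fs \<Longrightarrow> cmod (F y) < 1) \<Longrightarrow> y \<in> W"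
proof -
  have x: "x \<in> topspace X" using W openin_subset by blast
  define C where "C = topspace X - W"
  have "closedin X C" using W(1) by (simp add: C_def closedin_diff)
  then have cpt: "compactin X C" by (rule compactin_if_closedin)
  have "\<exists>F. alg F \<and> F x = 0 \<and> cmod (F y) > 1" if y: "y \<in> C" for y
  proof -
    obtain G where G: "alg G" "G y \<noteq> G x"
      using alg_separates[of y x] x y W(2) by (auto simp: C_def)
    show ?thesis
      by (intro exI[of _ "\<lambda>z. 2 * ((G z - G x) / (G y - G x))"] conjI
          alg_divide_const alg_cmult alg_diff alg_const G)
        (use G(2) in \<open>auto simp: norm_divide norm_mult\<close>)
  qed
  then obtain f where f: "\<And>y. y \<in> C \<Longrightarrow> alg (f y)" "\<And>y. y \<in> C \<Longrightarrow> f y x = 0"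
      "\<And>y. y \<in> C \<Longrightarrow> cmod (f y y) > 1" by metis
  define O' where "O' y = {z \<in> topspace X. f y z \<in> - cball 0 1}" for y
  have openO: "openin X (O' y)" if "y \<in> C" for y
    unfolding O'_def by (rule openin_alg_preimage[OF f(1)[OF that]]) (simp add: open_Compl)
  have inO: "y \<in> O' y" if "y \<in> C" for y
    using f(3)[OF that] that by (simp add: O'_def C_def)
  have "\<exists>\<F>. finite \<F> \<and> \<F> \<subseteq> O' ` C \<and> C \<subseteq> \<Union>\<F>"
    using cpt unfolding compactin_def
  proof (elim conjE allE[of _ "O' ` C"] impE)
    show "(\<forall>U\<in>O' ` C. openin X U) \<and> C \<subseteq> \<Union>(O' ` C)"
      using openO inO by blast
  qed auto
  then obtain D where D: "finite D" "D \<subseteq> C" "C \<subseteq> \<Union>(O' ` D)"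
    by (metis finite_subset_image)
  show ?thesis
  proof
    show "finite (f ` D)" using D(1) by simp
    show "y \<in> W" if y: "y \<in> topspace X" "\<And>F. F \<in> f ` D \<Longrightarrow> cmod (F y) < 1" for y
    proof (rule ccontr)
      assume "y \<notin> W"
      then obtain d where "d \<in> D" "y \<in> O' d" using y(1) D(3) by (auto simp: C_def)
      then show False using y(2)[of "f d"] by (auto simp: O'_def)
    qed
  qed (use D(2) f in auto)
qed

text \<open>If a function peaked only on \<open>V\<close> inside \<open>E\<close>, then multiplying a high power of it by the
  functions that define \<open>V\<close> would show that it peaks only on \<open>V\<close> in all of \<open>X\<close>, hence not on \<open>H\<close>.\<close>

lemma is_boundary_diff:
  assumes Fs: "finite Fs" "\<And>F. F \<in> Fs \<Longrightarrow> alg F"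
    and V: "V = {y \<in> topspace X. \<forall>F\<in>Fs. cmod (F y) < 1}"
    and E: "is_boundary X \<A> E" and H: "is_boundary X \<A> H" and "H \<inter> V = {}"
  shows "is_boundary X \<A> (E - V)"
proof (rule ccontr)
  assume no: "\<not> ?thesis"
  have "openin X V" unfolding V using Fs by (rule openin_basic_neighbourhood)
  moreover have clE: "closedin X E" using E by (simp add: is_boundary_def)
  ultimately have cl: "closedin X (E - V)" by (rule closedin_diff[rotated])
  obtain G x0 r where G: "alg G" and x0: "x0 \<in> topspace X" "cmod (G x0) = 1"
    and le1: "\<And>x. x \<in> topspace X \<Longrightarrow> cmod (G x) \<le> 1"
    and r: "0 \<le> r" "r < 1" "\<And>x. x \<in> E - V \<Longrightarrow> cmod (G x) \<le> r"
  proof (cases "E - V = {}")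
    case True
    obtain x where "x \<in> topspace X" using nonempty_X by blast
    \<comment> \<open>With \<open>E - V\<close> empty the bound on it is vacuous, so a constant
      serves.\<close>
    then show ?thesis by (intro that[of "\<lambda>x. 1" x 0] alg_const) (use True in auto)
  next
    case False
    from no cl obtain F x where F: "alg F" and x: "x \<in> topspace X"
      and Fx: "\<And>y. y \<in> E - V \<Longrightarrow> cmod (F y) < cmod (F x)"
      unfolding is_boundary_iff by (meson not_le)
    obtain x0 where x0: "x0 \<in> topspace X" "\<And>x. x \<in> topspace X \<Longrightarrow> cmod (F x) \<le> cmod (F x0)"
      using alg_attains_max[OF F closedin_topspace nonempty_X] by blast
    obtain y where y: "y \<in> E - V" "\<And>x. x \<in> E - V \<Longrightarrow> cmod (F x) \<le> cmod (F y)"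
      using alg_attains_max[OF F cl False] by blast
    have lt: "cmod (F y) < cmod (F x0)"
      using Fx[OF y(1)] x0(2)[OF x] by simp
    then have pos: "cmod (F x0) > 0" using norm_ge_zero order_le_less_trans by blast
    show ?thesis
      by (rule that[of "\<lambda>x. F x / F x0" x0 "cmod (F y) / cmod (F x0)"])
        (use pos lt y x0 F in \<open>auto simp: norm_divide divide_right_mono intro: alg_divide_const\<close>)
  qed
  have "\<exists>B. \<forall>F\<in>Fs. \<forall>x\<in>topspace X. cmod (F x) \<le> B"
  proof -
    have "\<forall>F\<in>Fs. \<exists>B. \<forall>x\<in>topspace X. cmod (F x) \<le> B"
      using alg_bounded Fs(2) by meson
    then obtain b where b: "\<And>F x. F \<in> Fs \<Longrightarrow> x \<in> topspace X \<Longrightarrow> cmod (F x) \<le> b F" by metis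
    then have "cmod (F x) \<le> Max (b ` Fs)" if "F \<in> Fs" "x \<in> topspace X" for F x
      using that Fs(1) by (meson Max_ge finite_imageI image_eqI order_trans)
    then show ?thesis by blast
  qed
  then obtain B where B: "\<And>F x. F \<in> Fs \<Longrightarrow> x \<in> topspace X \<Longrightarrow> cmod (F x) \<le> B" by blast
  have "0 < 1 / (\<bar>B\<bar> + 1)" by (simp add: add_nonneg_pos)
  from real_arch_pow_inv[OF this r(2)] obtain n where n: "r ^ n < 1 / (\<bar>B\<bar> + 1)" by blast
  \<comment> \<open>On \<open>V\<close> the function \<open>F\<close> is below 1 and
    \<open>G\<close> at most 1; off \<open>V\<close> the factor \<open>r ^ n\<close> outweighs the
    bound of \<open>F\<close>.\<close>
  have small: "cmod (G y ^ n * F y) < 1" if F: "F \<in> Fs" and y: "y \<in> E" for F y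
  proof -
    have yX: "y \<in> topspace X" using y clE closedin_subset by blast
    show ?thesis
    proof (cases "y \<in> V")
      case True
      have "cmod (G y ^ n * F y) \<le> 1 * cmod (F y)"
        unfolding norm_mult norm_power using le1[OF yX]
        by (intro mult_right_mono power_le_one) auto
      also have "\<dots> < 1" using True F by (simp add: V)
      finally show ?thesis .
    next
      case False
      have "cmod (G y ^ n * F y) \<le> r ^ n * \<bar>B\<bar>"
        unfolding norm_mult norm_power using r(1) r(3)[of y] y False B[OF F yX]
        by (intro mult_mono power_mono) auto
      also have "\<dots> \<le> 1 / (\<bar>B\<bar> + 1) * \<bar>B\<bar>" using n by (intro mult_right_mono) auto
      also have "\<dots> < 1" by simp
      finally show ?thesis .
    qed
  qed
  \<comment> \<open>The bound on the boundary \<open>E\<close> carries over to \<open>z\<close>,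
    where the factor \<open>G z ^ n\<close> has modulus 1.\<close>
  have peak: "z \<in> V" if z: "z \<in> topspace X" "cmod (G z) = 1" for z
    unfolding V
  proof (intro CollectI conjI ballI z(1))
    fix F assume F: "F \<in> Fs"
    have "alg (\<lambda>x. G x ^ n * F x)" by (intro alg_mult alg_power G Fs(2)[OF F])
    then obtain y where "y \<in> E" "cmod (G z ^ n * F z) \<le> cmod (G y ^ n * F y)"
      using E z(1) unfolding is_boundary_iff by blast
    then have "cmod (G z ^ n * F z) < 1" using small[OF F] by fastforce
    then show "cmod (F z) < 1" by (simp add: norm_mult norm_power z(2))
  qed
  obtain y where y: "y \<in> H" "cmod (G x0) \<le> cmod (G y)"
    using H x0(1) G unfolding is_boundary_iff by blast
  have "y \<in> topspace X" using y(1) H closedin_subset unfolding is_boundary_def by blast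
  then have "y \<in> V" using peak le1[of y] x0(2) y(2) by force
  then show False using y(1) \<open>H \<inter> V = {}\<close> by blast
qed

lemma is_boundary_topspace: "is_boundary X \<A> (topspace X)"
  unfolding is_boundary_def by simp

text \<open>The compact set \<open>P\<close> where a counterexample \<open>F\<close> has maximum
  modulus misses the intersection, so each of its points has a basic neighbourhood disjoint from
  some boundary. Removing finitely many of these that cover \<open>P\<close>, one by one with
  \<open>is_boundary_diff\<close>, leaves a boundary on which \<open>F\<close> stays below its
  maximum.\<close>

lemma is_boundary_Inter: "is_boundary X \<A> (\<Inter>{H. is_boundary X \<A> H})"
proof (rule ccontr)
  define S where "S = \<Inter>{H. is_boundary X \<A> H}"
  have cl: "closedin X S" unfolding S_def
    using is_boundary_topspace by (intro closedin_Inter) (auto simp: is_boundary_def)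
  assume "\<not> is_boundary X \<A> (\<Inter>{H. is_boundary X \<A> H})"
  then obtain F x where F: "alg F" and x: "x \<in> topspace X"
    and Fx: "\<And>y. y \<in> S \<Longrightarrow> cmod (F y) < cmod (F x)"
    using cl unfolding is_boundary_iff[of S, unfolded S_def] S_def by (meson not_le)
  obtain x0 where x0: "x0 \<in> topspace X" "\<And>x. x \<in> topspace X \<Longrightarrow> cmod (F x) \<le> cmod (F x0)"
    using alg_attains_max[OF F closedin_topspace nonempty_X] by blast
  define P where "P = {y \<in> topspace X. F y \<in> sphere 0 (cmod (F x0))}"
  have cpt: "compactin X P" unfolding P_def
    by (intro compactin_if_closedin closedin_alg_preimage F) auto
  define V where "V Fs = {y \<in> topspace X. \<forall>F\<in>Fs. cmod (F y) < 1}" for Fs :: "('x \<Rightarrow> complex) set"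
  have "\<exists>Fs H. finite Fs \<and> (\<forall>F\<in>Fs. alg F) \<and> is_boundary X \<A> H \<and> V Fs \<inter> H = {} \<and> y \<in> V Fs"
    if y: "y \<in> P" for y
  proof -
    have "y \<notin> S" using Fx[of y] x0(2)[OF x] y by (auto simp: P_def)
    then obtain H where H: "is_boundary X \<A> H" "y \<notin> H" by (auto simp: S_def)
    then have W: "openin X (topspace X - H)" "y \<in> topspace X - H"
      using y by (auto simp: is_boundary_def P_def)
    obtain Fs where Fs: "finite Fs" "\<And>F. F \<in> Fs \<Longrightarrow> alg F" "\<And>F. F \<in> Fs \<Longrightarrow> F y = 0"
      "\<And>z. z \<in> topspace X \<Longrightarrow> (\<And>F. F \<in> Fs \<Longrightarrow> cmod (F z) < 1) \<Longrightarrow> z \<in> topspace X - H"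
      using basic_neighbourhood[OF W] by blast
    have "V Fs \<inter> H = {}" using Fs(4) by (force simp: V_def)
    moreover have "cmod (F y) < 1" if "F \<in> Fs" for F using Fs(3)[OF that] by simp
    then have "y \<in> V Fs" using W(2) by (simp add: V_def)
    ultimately show ?thesis using Fs(1,2) H(1) by blast
  qed
  then obtain Fs H where FsH: "\<And>y. y \<in> P \<Longrightarrow> finite (Fs y)" "\<And>y F. y \<in> P \<Longrightarrow> F \<in> Fs y \<Longrightarrow> alg F"
    "\<And>y. y \<in> P \<Longrightarrow> is_boundary X \<A> (H y)" "\<And>y. y \<in> P \<Longrightarrow> V (Fs y) \<inter> H y = {}"
    "\<And>y. y \<in> P \<Longrightarrow> y \<in> V (Fs y)" by metis
  have openV: "openin X (V (Fs y))" if "y \<in> P" for y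
    unfolding V_def using FsH(1,2)[OF that] by (rule openin_basic_neighbourhood)
  have "\<exists>\<F>. finite \<F> \<and> \<F> \<subseteq> (\<lambda>y. V (Fs y)) ` P \<and> P \<subseteq> \<Union>\<F>"
    using cpt unfolding compactin_def
  proof (elim conjE allE[of _ "(\<lambda>y. V (Fs y)) ` P"] impE)
    show "(\<forall>U\<in>(\<lambda>y. V (Fs y)) ` P. openin X U) \<and> P \<subseteq> \<Union>((\<lambda>y. V (Fs y)) ` P)"
      using openV FsH(5) by blast
  qed auto
  then obtain D where D: "finite D" "D \<subseteq> P" "P \<subseteq> (\<Union>y\<in>D. V (Fs y))"
    by (metis finite_subset_image)
  have "is_boundary X \<A> (topspace X - (\<Union>y\<in>D. V (Fs y)))"
    using D(1,2)
  proof (induction D)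
    case empty then show ?case by (simp add: is_boundary_topspace)
  next
    case (insert d D)
    then have d: "d \<in> P" by simp
    have "is_boundary X \<A> ((topspace X - (\<Union>y\<in>D. V (Fs y))) - V (Fs d))"
      by (rule is_boundary_diff[OF FsH(1,2)[OF d] V_def _ FsH(3)[OF d]])
        (use insert FsH(4)[OF d] in auto)
    moreover have "(topspace X - (\<Union>y\<in>D. V (Fs y))) - V (Fs d)
        = topspace X - (\<Union>y\<in>insert d D. V (Fs y))" by auto
    ultimately show ?case by simp
  qed
  then obtain y where "y \<in> topspace X - (\<Union>y\<in>D. V (Fs y))" "cmod (F x0) \<le> cmod (F y)"
    unfolding is_boundary_iff using F x0(1) by blast
  then have "y \<in> P" "y \<notin> (\<Union>y\<in>D. V (Fs y))" using x0(2) by (auto simp: P_def intro: antisym)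
  then show False using D(3) by blast
qed

lemma shilov_boundary_subset:
  assumes "is_boundary X \<A> H"
  shows "shilov_boundary X \<A> \<subseteq> H"
proof -
  have "shilov_boundary X \<A> = \<Inter>{H. is_boundary X \<A> H}"
    unfolding shilov_boundary_def by (rule Least_equality) (use is_boundary_Inter in auto)
  then show ?thesis using assms by blast
qed

section \<open>Functions that peak inside an open set\<close>

lemma peak_function:
  assumes U: "openin X U" and no: "\<not> is_boundary X \<A> (topspace X - U)" and ne: "topspace X - U \<noteq> {}"
  obtains f r x0 where "alg f" "x0 \<in> topspace X" "f x0 = 1" "0 \<le> r" "r < 1"
    "\<And>x. x \<in> topspace X - U \<Longrightarrow> cmod (f x) \<le> r"
proof -
  have cl: "closedin X (topspace X - U)" using U by (simp add: closedin_diff)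
  from no cl obtain F x where F: "alg F" and x: "x \<in> topspace X"
    and Fx: "\<And>y. y \<in> topspace X - U \<Longrightarrow> cmod (F y) < cmod (F x)"
    unfolding is_boundary_iff by (meson not_le)
  obtain y where y: "y \<in> topspace X - U" "\<And>x. x \<in> topspace X - U \<Longrightarrow> cmod (F x) \<le> cmod (F y)"
    by (rule alg_attains_max[OF F cl ne]) (rule that)
  have lt: "cmod (F y) < cmod (F x)" by (rule Fx[OF y(1)])
  then have pos: "cmod (F x) > 0" using norm_ge_zero order_le_less_trans by blast
  show ?thesis
  proof (rule that)
    show "alg (\<lambda>z. F z / F x)" by (rule alg_divide_const[OF F])
    show "F x / F x = 1" using pos by simp
    show "cmod (F y) / cmod (F x) < 1" using lt pos by simp
    show "cmod (F z / F x) \<le> cmod (F y) / cmod (F x)" if "z \<in> topspace X - U" for z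
      unfolding norm_divide by (rule divide_right_mono[OF y(2)[OF that]]) simp
  qed (use x in simp_all)
qed

text \<open>A function with values 0 at \<open>p\<close> and 1 at \<open>q\<close> is multiplied by
  a high power of \<open>f / f q\<close>, which is 1 at \<open>q\<close> and small off
  \<open>U\<close>. With the bound 1/4, differences of two such functions are at most 1/2 off
  \<open>U\<close>.\<close>

lemma peaked_separation:
  assumes f: "alg f" "\<And>x. x \<in> topspace X - U \<Longrightarrow> cmod (f x) \<le> r" "0 \<le> r"
    and pq: "p \<in> topspace X" "q \<in> topspace X" "p \<noteq> q" and "r < cmod (f q)"
  obtains g where "alg g" "g p = 0" "g q = 1" "\<And>x. x \<in> topspace X - U \<Longrightarrow> cmod (g x) \<le> 1 / 4"
proof -
  obtain E where E: "alg E" "E p \<noteq> E q" by (rule alg_separates[OF pq])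
  define D where "D x = (E x - E p) / (E q - E p)" for x
  have D: "alg D" unfolding D_def by (intro alg_divide_const alg_diff alg_const E(1))
  obtain B where B: "B > 0" "\<And>x. x \<in> topspace X \<Longrightarrow> cmod (D x) \<le> B"
    by (rule alg_bounded[OF D]) (rule that)
  have fq: "f q \<noteq> 0" using assms(3,7) by auto
  have "r / cmod (f q) < 1" using assms(3,7) by (simp add: divide_less_eq)
  from real_arch_pow_inv[OF _ this, of "1 / (4 * B)"] obtain n where n: "(r / cmod (f q)) ^ n < 1 / (4 * B)"
    using B(1) by auto
  show ?thesis
  proof (rule that)
    show "alg (\<lambda>x. (f x / f q) ^ n * D x)" by (intro alg_mult alg_power alg_divide_const f(1) D)
    show "(f p / f q) ^ n * D p = 0" by (simp add: D_def)
    show "(f q / f q) ^ n * D q = 1" using fq E(2) by (simp add: D_def)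
    fix x assume x: "x \<in> topspace X - U"
    have "cmod ((f x / f q) ^ n * D x) = (cmod (f x) / cmod (f q)) ^ n * cmod (D x)"
      by (simp add: norm_mult norm_power norm_divide)
    also have "\<dots> \<le> (r / cmod (f q)) ^ n * B"
      using f(2)[OF x] B(2)[of x] x assms(3)
      by (intro mult_mono power_mono divide_right_mono) auto
    also have "\<dots> \<le> 1 / (4 * B) * B" using n B(1) by (intro mult_right_mono) auto
    also have "\<dots> = 1 / 4" using B(1) by simp
    finally show "cmod ((f x / f q) ^ n * D x) \<le> 1 / 4" .
  qed
qed

end

section \<open>Removability\<close>

context function_algebra
begin

theorem is_boundary_complement:
  fixes K :: "'a::linorder_topology set" and m :: "'a \<Rightarrow> real"
  assumes triv: "idempotents_trivial X \<A>"
    and U: "openin X U" "U \<subset> topspace X"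
    and homeo: "subtopology X (X closure_of U) homeomorphic_space subtopology euclidean K"
    and K: "distribution_function K m"
    and no_cantor: "\<not> (\<exists>S :: 'a set. S homeomorphic cantor_set)"
  shows "is_boundary X \<A> (topspace X - U)"
proof (rule ccontr)
  interpret distribution_function K m by (rule K)
  assume no: "\<not> is_boundary X \<A> (topspace X - U)"
  obtain f r x0 where f: "alg f" "x0 \<in> topspace X" "f x0 = 1" "0 \<le> r" "r < 1"
    "\<And>x. x \<in> topspace X - U \<Longrightarrow> cmod (f x) \<le> r"
    by (rule peak_function[OF U(1) no]) (use U(2) in blast, rule that)
  obtain y0 where y0: "y0 \<in> topspace X - U" using U(2) by blast
  obtain h k where hk: "homeomorphic_maps (subtopology X (X closure_of U)) (subtopology euclidean K) h k"
    using homeo unfolding homeomorphic_space_def by blast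
  have "U \<subseteq> topspace (subtopology X (X closure_of U))"
    using closure_of_subset[OF openin_subset[OF U(1)]] openin_subset[OF U(1)] by auto
  then have h: "h x \<in> K" "k (h x) = x" if "x \<in> U" for x
    using hk that unfolding homeomorphic_maps_def continuous_map_def by auto
  have k_cont: "continuous_map (subtopology euclidean K) X k"
    using hk unfolding homeomorphic_maps_def by (auto dest: continuous_map_into_fulltopology)
  then have k: "k p \<in> topspace X" if "p \<in> K" for p
    using that unfolding continuous_map_def by auto
  have k_inj: "k p \<noteq> k q" if "p \<in> K" "q \<in> K" "p \<noteq> q" for p q
    using hk that unfolding homeomorphic_maps_def by (metis topspace_euclidean_subtopology)
  have cont: "continuous_on K (\<lambda>p. g (k p))" if "alg g" for g
    using continuous_map_compose[OF k_cont alg_continuous[OF that]] by (simp add: comp_def)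
  \<comment> \<open>Midway between \<open>r\<close> and 1: on \<open>L\<close> the modulus of
    \<open>f\<close> exceeds \<open>r\<close>, as \<open>peaked_separation\<close> requires, and an
    interval of values below 1 remains.\<close>
  define c1 where "c1 = (r + 1) / 2"
  define L where "L = {p \<in> K. c1 \<le> Re (f (k p))}"
  have "L \<subseteq> K" by (auto simp: L_def)
  have "compact L"
  proof -
    have "continuous_on K (\<lambda>p. Re (f (k p)))" by (intro continuous_intros cont[OF f(1)])
    then have "closed ((\<lambda>p. Re (f (k p))) -` {c1..} \<inter> K)"
      using continuous_on_closed_vimage[OF compact_imp_closed[OF compact_K]] closed_atLeast by blast
    from compact_Int_closed[OF compact_K this] show ?thesis
      by (rule back_subst[of compact]) (auto simp: L_def)
  qed
  have "uncountable L"
  proof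
    assume "countable L"
    \<comment> \<open>Values above \<open>r\<close> are attained only in \<open>U\<close>, hence at
      points that \<open>h\<close> carries into \<open>L\<close>.\<close>
    have "{c1..<1} \<subseteq> (\<lambda>p. Re (f (k p))) ` L"
    proof
      fix c assume c: "c \<in> {c1..<1}"
      then have "r < c" using f(5) by (simp add: c1_def)
      have "\<exists>z\<in>topspace X. Re (f z) = c"
      proof (rule idempotents_trivial_Re[OF triv f(1)])
        show "Re (f y0) < c" using f(6)[OF y0] complex_Re_le_cmod[of "f y0"] \<open>r < c\<close> by linarith
        show "c < Re (f x0)" using c f(3) by simp
      qed (use y0 f(2) in auto)
      then obtain z where z: "z \<in> topspace X" "Re (f z) = c" by blast
      have "z \<in> U" using f(6)[of z] z complex_Re_le_cmod[of "f z"] \<open>r < c\<close> by force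
      then have "h z \<in> L" using h z(2) c by (simp add: L_def)
      moreover have "c = Re (f (k (h z)))" using h(2)[OF \<open>z \<in> U\<close>] z(2) by simp
      ultimately show "c \<in> (\<lambda>p. Re (f (k p))) ` L" by blast
    qed
    from countable_subset[OF this countable_image[OF \<open>countable L\<close>]] have "countable {c1..<1}" .
    moreover have "c1 < 1" using f(5) by (simp add: c1_def)
    ultimately show False using uncountable_half_open_interval_1[of c1 1] by blast
  qed
  define A where "A = {a \<in> L. \<exists>b\<in>L. jump K a b \<and> m a = m b}"
  have "uncountable A"
    unfolding A_def by (rule uncountable_jumps[OF \<open>L \<subseteq> K\<close> \<open>compact L\<close> \<open>uncountable L\<close> no_cantor])
  have "inj_on m A" unfolding A_def by (rule inj_on_m_jumps)
  then have T: "uncountable (m ` A)"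
    using \<open>uncountable A\<close> countable_image_inj_on by blast
  have "\<exists>a b g. jump K a b \<and> m a = t \<and> m b = t \<and> alg g \<and> g (k a) = 0 \<and> g (k b) = 1 \<and>
      (\<forall>x\<in>topspace X - U. cmod (g x) \<le> 1 / 4)" if "t \<in> m ` A" for t
  proof -
    obtain a b where ab: "a \<in> L" "b \<in> L" "jump K a b" "m a = t" "m b = t"
      using \<open>t \<in> m ` A\<close> unfolding A_def by auto
    have K: "a \<in> K" "b \<in> K" "a \<noteq> b" using ab(3) by (auto simp: jump_def)
    have lt: "r < cmod (f (k b))"
      using ab(2) complex_Re_le_cmod[of "f (k b)"] f(5) by (simp add: L_def c1_def)
    obtain g where g: "alg g" "g (k a) = 0" "g (k b) = 1" "\<And>x. x \<in> topspace X - U \<Longrightarrow> cmod (g x) \<le> 1 / 4"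
      by (rule peaked_separation[OF f(1,6,4) k[OF K(1)] k[OF K(2)] k_inj[OF K] lt]) (assumption, rule that)
    then show ?thesis using ab(3-5) by blast
  qed
  then obtain a b g where abg: "\<And>t. t \<in> m ` A \<Longrightarrow> jump K (a t) (b t) \<and> m (a t) = t \<and> m (b t) = t \<and>
      alg (g t) \<and> g t (k (a t)) = 0 \<and> g t (k (b t)) = 1 \<and> (\<forall>x\<in>topspace X - U. cmod (g t x) \<le> 1 / 4)"
    by metis
  obtain s t c x where st: "s \<in> m ` A" "t \<in> m ` A" "1 / 2 < c" "x \<in> K" "c < Re (g s (k x) - g t (k x))"
    "\<And>x. x \<in> K \<Longrightarrow> Re (g s (k x) - g t (k x)) \<noteq> c"
  proof (rule jump_family_difference[of "m ` A" a b "\<lambda>t x. g t (k x)", OF T])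
    show "continuous_on K (\<lambda>x. g t (k x))" if "t \<in> m ` A" for t
      using abg[OF that] cont by blast
  qed (use abg that in blast)+
  have outside: "Re (g s z - g t z) < c" if "z \<in> topspace X - U" for z
  proof -
    have "cmod (g s z) \<le> 1 / 4" "cmod (g t z) \<le> 1 / 4"
      using abg[OF st(1)] abg[OF st(2)] that by blast+
    then show ?thesis
      using complex_Re_le_cmod[of "g s z - g t z"] norm_triangle_ineq4[of "g s z" "g t z"] st(3) by linarith
  qed
  have "\<exists>z\<in>topspace X. Re (g s z - g t z) = c"
  proof (rule idempotents_trivial_Re[OF triv])
    show "alg (\<lambda>z. g s z - g t z)" using abg[OF st(1)] abg[OF st(2)] alg_diff by blast
    show "Re (g s y0 - g t y0) < c" by (rule outside[OF y0])
    show "c < Re (g s (k x) - g t (k x))" by (rule st(5))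
  qed (use y0 k st(4) in auto)
  \<comment> \<open>The value \<open>c\<close> can be attained only in \<open>U\<close>, that is, at
    the image under \<open>k\<close> of a point of \<open>K\<close>, where it is excluded.\<close>
  then obtain z where z: "z \<in> topspace X" "Re (g s z - g t z) = c" by blast
  then have "z \<in> U" using outside[of z] by force
  then show False using st(6)[OF h(1)] h(2) z(2) by simp
qed

end

lemma Hausdorff_space_euclidean_t2: "Hausdorff_space (euclidean :: 'a::t2_space topology)"
  unfolding Hausdorff_space_def disjnt_def topspace_euclidean open_openin[symmetric]
  using hausdorff by blast

text \<open>The closure of \<open>U\<close> is a copy of a compact subset \<open>K\<close> of the
  support, and the distribution function of the total variation is strict at the points of
  \<open>K\<close>. So \<open>is_boundary_complement\<close> applies.\<close>

theorem lemma2p19: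
  assumes "compact (UNIV :: 'a::linorder_topology set)"
    and "\<not> (\<exists>S :: 'a set. S homeomorphic cantor_set)"
  shows "pseudo_removable TYPE('x) (euclidean :: 'a topology)"
  unfolding pseudo_removable_def
proof (intro conjI allI impI)
  show "compact_space (euclidean :: 'a topology)" using assms(1) by (simp add: compact_space_def)
  show "Hausdorff_space (euclidean :: 'a topology)" by (rule Hausdorff_space_euclidean_t2)
  fix \<mu> :: "'a set \<Rightarrow> complex" assume "regular_complex_borel_measure euclidean \<mu>"
  then have \<mu>: "complex_borel_measure euclidean \<mu>" by (simp add: regular_complex_borel_measure_def)
  obtain m :: "'a \<Rightarrow> real" where m: "mono m"
    "\<And>a b c. b \<in> supt euclidean \<mu> \<Longrightarrow> a < b \<Longrightarrow> b < c \<Longrightarrow> m a < m c"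
    by (rule supt_distribution[OF \<mu>]) (rule that)
  define S where "S = supt euclidean \<mu>"
  have "closed S" unfolding S_def supt_def by (auto intro!: open_Union simp: closed_def double_diff)
  then have "compact S" using compact_Int_closed[OF assms(1)] by simp
  show "removable TYPE('x) (subtopology euclidean (supt euclidean \<mu>))"
    unfolding removable_def S_def[symmetric]
  proof (intro conjI allI impI)
    show "compact_space (subtopology euclidean S)"
      using \<open>compact S\<close> by (simp add: compact_space_subtopology)
    show "Hausdorff_space (subtopology euclidean S)" by (intro Hausdorff_space_subtopology Hausdorff_space_euclidean_t2)
    fix X :: "'x topology" and U \<A>
    assume *: "compact_space X \<and> Hausdorff_space X \<and> openin X U \<and> U \<subset> topspace X \<and>
        (\<exists>T\<subseteq>topspace (subtopology euclidean S).
          subtopology X (X closure_of U) homeomorphic_space subtopology (subtopology euclidean S) T) \<and>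
        closed_subalgebra X \<A> \<and> idempotents_trivial X \<A>"
    then obtain K where K: "K \<subseteq> S"
        "subtopology X (X closure_of U) homeomorphic_space subtopology (subtopology euclidean S) K"
      by auto
    have eq: "subtopology (subtopology euclidean S) K = subtopology euclidean K"
      using K(1) by (simp add: subtopology_subtopology Int_absorb1)
    \<comment> \<open>\<open>X\<close> is nonempty because \<open>U\<close> is a proper subset of
      it.\<close>
    interpret function_algebra X \<A> by unfold_locales (use * in auto)
    have "compactin X (X closure_of U)" by (rule compactin_if_closedin) simp
    then have "compact_space (subtopology X (X closure_of U))" by (rule compact_space_subtopology)
    then have "compact_space (subtopology euclidean K)"
      using homeomorphic_compact_space[OF K(2)] by (simp add: eq)
    then have "compact K" using compactin_subspace[of euclidean K] by simp
    have "distribution_function K m"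
      by unfold_locales (use \<open>compact K\<close> m K(1) in \<open>auto simp: S_def\<close>)
    from is_boundary_complement[OF _ _ _ K(2)[unfolded eq] this assms(2)] *
    show "shilov_boundary X \<A> \<subseteq> topspace X - U"
      by (intro shilov_boundary_subset) blast
  qed
qed

end
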